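(* Let $U=\{u_1,\dots,u_n\}$ and $V=\{v_1,\dots,v_m\}$ be disjoint finite sets, and let $0<c_1\le c_2<n$ and $0<d_1\le d_2<m$ be integers. Let $\mathbf d$ be a bipartite degree sequence on $U\uplus V$ which has at least one realization (a simple bipartite graph with classes $U,V$ in which each vertex has its prescribed degree) and satisfies $$c_1\le d(v)\le c_2\quad\forall v\in V,\qquad d_1\le d(u)\le d_2\quad\forall u\in U.$$ Assume furthermore that $$(c_2-c_1-1)(d_2-d_1-1)\le \max\{\,c_1(m-d_2),\ d_1(n-c_2)\,\}.$$ Then the swap Markov chain on the set of realizations of $\mathbf d$ is rapidly mixing.
   Context: Swap Markov chain on bipartite degree sequences: the state space $\mathcal G(\mathbf d)$ is the set of all simple bipartite graphs on vertex classes $U,V$ realizing $\mathbf d$. From the current realization $G$: with probability $1/2$ stay at $G$; with probability $1/2$ choose uniformly at random a $2$-subset $\{u_1,u_2\}\subseteq U$ and a $2$-subset $\{v_1,v_2\}\subseteq V$; if $u_1v_1,u_2v_2\in E(G)$ and $u_1v_2,u_2v_1\notin E(G)$, replace the edges $u_1v_1,u_2v_2$ by $u_1v_2,u_2v_1$ (a swap); similarly if $u_1v_2,u_2v_1\in E(G)$ and $u_1v_1,u_2v_2\notin E(G)$, replace $u_1v_2,u_2v_1$ by $u_1v_1,u_2v_2$; otherwise stay. Thus for $G'\neq G$ obtained from $G$ by one swap, $P(G\to G')=1/\big(2\binom{n}{2}\binom{m}{2}\big)$. This chain is irreducible, aperiodic and symmetric, with the uniform stationary distribution $\pi$. Rapidly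 mixing means: the mixing time $\tau(\varepsilon)=\max_{G}\min\{t:\ \|P^t(G,\cdot)-\pi\|_{TV}\le\varepsilon\}$ is bounded by a polynomial in $n+m$ and $\log(1/\varepsilon)$, the polynomial being uniform over all degree sequences satisfying the hypotheses. *)

theory Defs
  imports Complex_Main
begin

text \<open>Vertex classes: U = {0..<n} (vertices u_i) and V = {0..<m} (vertices v_j),
  kept disjoint by working with pairs. A bipartite graph is its edge set
  G \<subseteq> {0..<n} \<times> {0..<m}; (i,j) \<in> G means u_i v_j is an edge.
  A bipartite degree sequence is a pair du (degrees on U), dv (degrees on V).\<close>

definition realizations :: "nat \<Rightarrow> nat \<Rightarrow> (nat \<Rightarrow> nat) \<Rightarrow> (nat \<Rightarrow> nat) \<Rightarrow> (nat \<times> nat) set set" where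
  "realizations n m du dv =
     {G. G \<subseteq> {0..<n} \<times> {0..<m}
         \<and> (\<forall>i<n. card {j. (i, j) \<in> G} = du i)
         \<and> (\<forall>j<m. card {i. (i, j) \<in> G} = dv j)}"

definition is_swap :: "(nat \<times> nat) set \<Rightarrow> (nat \<times> nat) set \<Rightarrow> bool" where
  "is_swap G G' \<longleftrightarrow> (\<exists>u1 u2 v1 v2. u1 \<noteq> u2 \<and> v1 \<noteq> v2 \<and>
      (u1, v1) \<in> G \<and> (u2, v2) \<in> G \<and> (u1, v2) \<notin> G \<and> (u2, v1) \<notin> G \<and>
      G' = (G - {(u1, v1), (u2, v2)}) \<union> {(u1, v2), (u2, v1)})"

definition swap_P :: "nat \<Rightarrow> nat \<Rightarrow> (nat \<Rightarrow> nat) \<Rightarrow> (nat \<Rightarrow> nat) \<Rightarrow>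
    (nat \<times> nat) set \<Rightarrow> (nat \<times> nat) set \<Rightarrow> real" where
  "swap_P n m du dv G G' =
     (let q = 1 / (2 * real (n choose 2) * real (m choose 2)) in
      if G' = G then 1 - q * real (card {H \<in> realizations n m du dv. H \<noteq> G \<and> is_swap G H})
      else if is_swap G G' then q else 0)"

fun swap_Pt :: "nat \<Rightarrow> nat \<Rightarrow> (nat \<Rightarrow> nat) \<Rightarrow> (nat \<Rightarrow> nat) \<Rightarrow> nat \<Rightarrow>
    (nat \<times> nat) set \<Rightarrow> (nat \<times> nat) set \<Rightarrow> real" where
  "swap_Pt n m du dv 0 G G' = (if G = G' then 1 else 0)"
| "swap_Pt n m du dv (Suc t) G G' =
     (\<Sum>H\<in>realizations n m du dv. swap_Pt n m du dv t G H * swap_P n m du dv H G')"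

definition swap_tv :: "nat \<Rightarrow> nat \<Rightarrow> (nat \<Rightarrow> nat) \<Rightarrow> (nat \<Rightarrow> nat) \<Rightarrow> nat \<Rightarrow>
    (nat \<times> nat) set \<Rightarrow> real" where
  "swap_tv n m du dv t G =
     (1/2) * (\<Sum>G'\<in>realizations n m du dv.
        \<bar>swap_Pt n m du dv t G G' - 1 / real (card (realizations n m du dv))\<bar>)"

definition mixing_time :: "nat \<Rightarrow> nat \<Rightarrow> (nat \<Rightarrow> nat) \<Rightarrow> (nat \<Rightarrow> nat) \<Rightarrow> real \<Rightarrow> nat" where
  "mixing_time n m du dv \<epsilon> =
     Max ((\<lambda>G. LEAST t. swap_tv n m du dv t G \<le> \<epsilon>) ` realizations n m du dv)"

end

theory Submission
  imports Defs "HOL-Combinatorics.Permutations"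
begin

text \<open>The spectral gap of the chain is bounded below by comparison with a Jerrum--Sinclair type chain on matchings.

  Realizations are encoded as perfect matchings, represented as permutations, of an auxiliary bipartite graph;
  all realizations have the same number of encodings. Two perfect matchings are
  joined by rotating the cycles of their union one after the other with transpositions, and all intermediate
  permutations are perfect up to a single bad pair. A complementary permutation of the same kind, together with
  boundedly many nodes, determines the two endpoints, so the congestion is polynomial as soon
  as near-perfect matchings outnumber perfect ones by at most a polynomial factor.

  The graph of a near-perfect matching misses the prescribed degrees by at most one at two vertices. This is where
  the inequality on the degree bounds enters: it forces an augmenting path of length at most 7, so that the
  graph is within distance 9 of a realization. Finally, realizations at bounded Hamming distance are joined by
  boundedly many swaps, which turns the Poincare inequality for matchings into one for the swap chain.\<close>

section \<open>Exchanging the cycles of two permutations\<close>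

text \<open>The encoding is in the spirit of Tutte's reduction of degree-constrained subgraphs to
  perfect matchings. It is used because the difference of two realizations splits into alternating
  circuits in many ways, whereas two perfect matchings \<open>s\<close> and \<open>t\<close> have
  the cycles of \<open>inv s \<circ> t\<close> as a canonical decomposition. The price is a huge
  number of encodings per realization. It occurs squared on both sides of the final comparison, as a
  lower bound for perfect matchings and as an upper bound for near-perfect ones, and cancels. What
  is left is polynomial because Hamming balls of bounded radius are. No flow is set up explicitly:
  squared differences are summed over all pairs of matchings and telescoped, and every intermediate
  stage is an injective or bijective function of the pair, so that the sums can be reindexed. The
  radii become exponents: 7 for an augmenting path, 9 after at most two removed edges, 9 + 2 + 9 =
  20 for the projections of two matchings that differ by a transposition, and 5 * 20 = 100 for the
  ball containing a swap path between them.\<close>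

lemma weighted_sum_square_le:
  fixes w x :: "'a \<Rightarrow> real"
  assumes "\<And>i. i \<in> I \<Longrightarrow> 0 \<le> w i"
  shows "(\<Sum>i\<in>I. w i * x i)\<^sup>2 \<le> (\<Sum>i\<in>I. w i) * (\<Sum>i\<in>I. w i * (x i)\<^sup>2)"
proof -
  have "0 \<le> (\<Sum>i\<in>I. \<Sum>j\<in>I. w i * w j * (x i - x j)\<^sup>2)"
    using assms by (intro sum_nonneg) simp
  also have "\<dots> = (\<Sum>i\<in>I. \<Sum>j\<in>I. w j * (w i * (x i)\<^sup>2)) + (\<Sum>i\<in>I. \<Sum>j\<in>I. w i * (w j * (x j)\<^sup>2))
     - 2 * (\<Sum>i\<in>I. \<Sum>j\<in>I. (w i * x i) * (w j * x j))"
    by (simp add: sum_distrib_left power2_eq_square algebra_simps flip: sum.distrib sum_subtractf)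
  also have "(\<Sum>i\<in>I. \<Sum>j\<in>I. w j * (w i * (x i)\<^sup>2)) = (\<Sum>i\<in>I. w i) * (\<Sum>i\<in>I. w i * (x i)\<^sup>2)"
    by (subst sum.swap) (simp add: sum_product)
  also have "(\<Sum>i\<in>I. \<Sum>j\<in>I. w i * (w j * (x j)\<^sup>2)) = (\<Sum>i\<in>I. w i) * (\<Sum>i\<in>I. w i * (x i)\<^sup>2)"
    by (simp add: sum_product)
  also have "(\<Sum>i\<in>I. \<Sum>j\<in>I. (w i * x i) * (w j * x j)) = (\<Sum>i\<in>I. w i * x i)\<^sup>2"
    by (simp add: sum_product power2_eq_square)
  finally show ?thesis by linarith
qed

lemma sum_square_le_card:
  fixes x :: "'a \<Rightarrow> real"
  shows "(\<Sum>i\<in>I. x i)\<^sup>2 \<le> real (card I) * (\<Sum>i\<in>I. (x i)\<^sup>2)"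
  using weighted_sum_square_le[of I "\<lambda>_. 1" x] by simp

lemma telescope_square_le:
  fixes g :: "nat \<Rightarrow> real"
  shows "(g 0 - g n)\<^sup>2 \<le> real n * (\<Sum>i<n. (g i - g (Suc i))\<^sup>2)"
proof -
  have "g 0 - g n = (\<Sum>i<n. g i - g (Suc i))"
    by (rule sum_lessThan_telescope'[symmetric])
  then show ?thesis using sum_square_le_card[of "\<lambda>i. g i - g (Suc i)" "{..<n}"] by simp
qed

section \<open>Unions of cycles of two permutations\<close>

definition balanced :: "'a set \<Rightarrow> ('a \<Rightarrow> 'a) \<times> ('a \<Rightarrow> 'a) \<Rightarrow> 'a set \<Rightarrow> bool" where
  "balanced A st D \<longleftrightarrow> D \<subseteq> A \<and> fst st ` D = snd st ` D"

text \<open>Balanced sets are the unions of cycles of \<open>inv s \<circ> t\<close> inside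
  \<open>A\<close>, so for \<open>S \<subseteq> A\<close> the hull is the union of the cycles
  meeting \<open>S\<close>. Speaking of equal images avoids cycles altogether and makes closure
  under Boolean operations immediate.\<close>

definition bal_hull :: "'a set \<Rightarrow> ('a \<Rightarrow> 'a) \<times> ('a \<Rightarrow> 'a) \<Rightarrow> 'a set \<Rightarrow> 'a set" where
  "bal_hull A st S = \<Inter>{D. balanced A st D \<and> S \<subseteq> D}"

definition exchange :: "('a \<Rightarrow> 'a) \<times> ('a \<Rightarrow> 'a) \<Rightarrow> 'a set \<Rightarrow> ('a \<Rightarrow> 'a) \<times> ('a \<Rightarrow> 'a)" where
  "exchange st D =
     ((\<lambda>x. if x \<in> D then snd st x else fst st x), (\<lambda>x. if x \<in> D then fst st x else snd st x))"

definition flip :: "'a set \<Rightarrow> 'a set \<Rightarrow> ('a \<Rightarrow> 'a) \<times> ('a \<Rightarrow> 'a) \<Rightarrow> ('a \<Rightarrow> 'a) \<times> ('a \<Rightarrow> 'a)" where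
  "flip A S st = exchange st (bal_hull A st S)"

lemma exchange_exchange_same [simp]: "exchange (exchange st D) D = st"
  by (cases st) (auto simp: exchange_def fun_eq_iff)

lemma exchange_disjoint: "D \<inter> E = {} \<Longrightarrow> exchange (exchange st D) E = exchange st (D \<union> E)"
  by (auto simp: exchange_def fun_eq_iff)

locale perm_pair =
  fixes A :: "'a set" and s t :: "'a \<Rightarrow> 'a"
  assumes s: "s permutes A" and t: "t permutes A"
begin

lemma inj_st: "inj s" "inj t"
  using s t by (simp_all add: permutes_inj)

lemma balanced_full: "balanced A (s, t) A"
  by (simp add: balanced_def permutes_image[OF s] permutes_image[OF t])

lemma balanced_Un: "balanced A (s, t) D \<Longrightarrow> balanced A (s, t) E \<Longrightarrow> balanced A (s, t) (D \<union> E)"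
  by (auto simp: balanced_def image_Un)

lemma balanced_Int: "balanced A (s, t) D \<Longrightarrow> balanced A (s, t) E \<Longrightarrow> balanced A (s, t) (D \<inter> E)"
  unfolding balanced_def using inj_st by (auto simp: image_Int)

lemma balanced_compl: "balanced A (s, t) D \<Longrightarrow> balanced A (s, t) (A - D)"
  unfolding balanced_def using inj_st
  by (auto simp: image_set_diff permutes_image[OF s] permutes_image[OF t])

lemma balanced_hull: 
  assumes "S \<subseteq> A" shows "balanced A (s, t) (bal_hull A (s, t) S)"
proof -
  let ?F = "{D. balanced A (s, t) D \<and> S \<subseteq> D}"
  have A: "A \<in> ?F" using balanced_full assms by simp
  have "s ` \<Inter>?F = (\<Inter>D\<in>?F. s ` D)" using image_INT[OF inj_st(1), of ?F "\<lambda>x. x" A] A by simp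
  also have "\<dots> = (\<Inter>D\<in>?F. t ` D)" by (rule INF_cong) (auto simp: balanced_def)
  also have "\<dots> = t ` \<Inter>?F" using image_INT[OF inj_st(2), of ?F "\<lambda>x. x" A] A by simp
  finally have "s ` \<Inter>?F = t ` \<Inter>?F" .
  with A show ?thesis by (auto simp: balanced_def bal_hull_def)
qed

lemma hull_least: "balanced A (s, t) D \<Longrightarrow> S \<subseteq> D \<Longrightarrow> bal_hull A (s, t) S \<subseteq> D"
  by (auto simp: bal_hull_def)

lemma hull_superset: "S \<subseteq> bal_hull A (s, t) S"
  by (auto simp: bal_hull_def)

lemma hull_insert_in:
  assumes "S \<subseteq> A" "a \<in> bal_hull A (s, t) S"
  shows "bal_hull A (s, t) (insert a S) = bal_hull A (s, t) S"
proof
  show "bal_hull A (s, t) (insert a S) \<subseteq> bal_hull A (s, t) S"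
    using assms hull_superset by (intro hull_least balanced_hull) auto
qed (auto simp: bal_hull_def)

text \<open>The complement of a balanced set is balanced, so the cycle of a new point avoids all
  cycles collected so far.\<close>

lemma hull_insert_notin:
  assumes "S \<subseteq> A" "a \<in> A" "a \<notin> bal_hull A (s, t) S"
  shows "bal_hull A (s, t) (insert a S) = bal_hull A (s, t) S \<union> bal_hull A (s, t) {a}"
    and "bal_hull A (s, t) S \<inter> bal_hull A (s, t) {a} = {}"
proof -
  show "bal_hull A (s, t) (insert a S) = bal_hull A (s, t) S \<union> bal_hull A (s, t) {a}"
  proof
    show "bal_hull A (s, t) (insert a S) \<subseteq> bal_hull A (s, t) S \<union> bal_hull A (s, t) {a}"
      using assms hull_superset[of S] hull_superset[of "{a}"]
      by (intro hull_least balanced_Un balanced_hull) auto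
  qed (auto simp: bal_hull_def)
  have "bal_hull A (s, t) {a} \<subseteq> A - bal_hull A (s, t) S"
    using assms by (intro hull_least balanced_compl balanced_hull) auto
  then show "bal_hull A (s, t) S \<inter> bal_hull A (s, t) {a} = {}" by blast
qed

lemma exchange_permutes:
  assumes "balanced A (s, t) D"
  shows "fst (exchange (s, t) D) permutes A" "snd (exchange (s, t) D) permutes A"
proof -
  have *: "(\<lambda>x. if x \<in> D then g x else f x) permutes A"
    if f: "f permutes A" and g: "g permutes A" and D: "D \<subseteq> A" "f ` D = g ` D" for f g :: "'a \<Rightarrow> 'a"
  proof (rule bij_imp_permutes)
    have "bij_betw g D (g ` D)" using permutes_inj[OF g] by (auto simp: bij_betw_def inj_on_def)
    moreover have "bij_betw f (A - D) (A - g ` D)"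
      using permutes_inj[OF f] permutes_image[OF f] D
      by (auto simp: bij_betw_def inj_on_def image_set_diff)
    ultimately have "bij_betw (\<lambda>x. if x \<in> D then g x else f x) (D \<union> (A - D)) (g ` D \<union> (A - g ` D))"
      by (intro bij_betw_disjoint_Un) auto
    moreover have "D \<union> (A - D) = A" "g ` D \<union> (A - g ` D) = A"
      using D permutes_image[OF g] by blast+
    ultimately show "bij_betw (\<lambda>x. if x \<in> D then g x else f x) A A" by simp
  next
    fix x assume "x \<notin> A" then show "(if x \<in> D then g x else f x) = x"
      using f g by (simp add: permutes_not_in)
  qed
  show "fst (exchange (s, t) D) permutes A" "snd (exchange (s, t) D) permutes A"
    using *[OF s t] *[OF t s] assms unfolding exchange_def balanced_def fst_conv snd_conv by auto
qed

lemma exchange_balanced: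
  assumes "balanced A (s, t) D" "balanced A (s, t) E"
  shows "balanced A (exchange (s, t) D) E"
proof -
  have "balanced A (s, t) (E \<inter> D)" "balanced A (s, t) (E \<inter> (A - D))"
    using assms balanced_Int balanced_compl by blast+
  then have 1: "s ` (E \<inter> D) = t ` (E \<inter> D)" "s ` (E \<inter> (A - D)) = t ` (E \<inter> (A - D))"
    by (auto simp: balanced_def)
  have E: "E = (E \<inter> D) \<union> (E \<inter> (A - D))" using assms by (auto simp: balanced_def)
  have "fst (exchange (s, t) D) ` E = t ` (E \<inter> D) \<union> s ` (E \<inter> (A - D))"
    by (subst E, subst image_Un) (auto simp: exchange_def image_iff)
  moreover have "snd (exchange (s, t) D) ` E = s ` (E \<inter> D) \<union> t ` (E \<inter> (A - D))"
    by (subst E, subst image_Un) (auto simp: exchange_def image_iff)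
  ultimately show ?thesis using assms 1 by (auto simp: balanced_def)
qed

end

text \<open>Exchanging is an involution, hence the one-sided \<open>exchange_balanced\<close> yields
  its own converse. Flipping some cycles therefore leaves all cycle supports unchanged, and later
  flips can be computed from the original pair.\<close>

lemma balanced_exchange_iff:
  assumes "s permutes A" "t permutes A" "balanced A (s, t) D"
  shows "balanced A (exchange (s, t) D) E \<longleftrightarrow> balanced A (s, t) E"
proof -
  interpret perm_pair A s t by standard (use assms in auto)
  obtain u v where uv: "exchange (s, t) D = (u, v)" by (cases "exchange (s, t) D")
  have "u permutes A" "v permutes A" using exchange_permutes[OF assms(3)] uv by auto
  then interpret uv: perm_pair A u v by unfold_locales
  have "balanced A (u, v) D" using exchange_balanced[OF assms(3) assms(3)] uv by simp
  then have "balanced A (u, v) E \<Longrightarrow> balanced A (s, t) E"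
    using uv.exchange_balanced[of D E] uv[symmetric] by simp
  then show ?thesis using exchange_balanced[OF assms(3)] uv by auto
qed

lemma hull_exchange:
  assumes "s permutes A" "t permutes A" "balanced A (s, t) D"
  shows "bal_hull A (exchange (s, t) D) S = bal_hull A (s, t) S"
  by (simp add: bal_hull_def balanced_exchange_iff[OF assms])

lemma flip_involution:
  assumes "s permutes A" "t permutes A" "S \<subseteq> A"
  shows "flip A S (flip A S (s, t)) = (s, t)"
proof -
  interpret perm_pair A s t by standard (use assms in auto)
  show ?thesis using balanced_hull[OF assms(3)] by (simp add: flip_def hull_exchange assms)
qed

text \<open>Starting from \<open>(s, t, a, t\<inverse> (s a))\<close>, the walk below follows the cycle of \<open>s\<inverse> \<circ> t\<close> through \<open>a\<close> and
  turns \<open>s\<close> into \<open>t\<close> along it by transpositions. At any time \<open>z\<close> agrees pointwise with \<open>s\<close> or \<open>t\<close>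
  except at \<open>p\<close>, and \<open>y\<close> -- which is \<open>s \<circ> z\<inverse> \<circ> t\<close> -- except at \<open>l\<close>. As the step does not mention \<open>s\<close> and \<open>t\<close>,
  the pair \<open>(s, t)\<close> can be decoded from any intermediate state.\<close>

fun walk_step :: "('a \<Rightarrow> 'a) \<times> ('a \<Rightarrow> 'a) \<times> 'a \<times> 'a \<Rightarrow> ('a \<Rightarrow> 'a) \<times> ('a \<Rightarrow> 'a) \<times> 'a \<times> 'a" where
  "walk_step (z, y, p, l) =
     (if p = l then (z, y, p, l)
      else (z \<circ> transpose p (inv z (y p)), y \<circ> transpose p l, inv z (y p), l))"

fun walk_start :: "'a \<Rightarrow> ('a \<Rightarrow> 'a) \<times> ('a \<Rightarrow> 'a) \<Rightarrow> ('a \<Rightarrow> 'a) \<times> ('a \<Rightarrow> 'a) \<times> 'a \<times> 'a" where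
  "walk_start a (s, t) = (s, t, a, inv t (s a))"

definition walk :: "'a \<Rightarrow> ('a \<Rightarrow> 'a) \<times> ('a \<Rightarrow> 'a) \<Rightarrow> nat \<Rightarrow> ('a \<Rightarrow> 'a) \<times> ('a \<Rightarrow> 'a) \<times> 'a \<times> 'a" where
  "walk a st k = (walk_step ^^ k) (walk_start a st)"

text \<open>\<open>D\<close> is the stretch of the cycle already turned from \<open>s\<close> to
  \<open>t\<close>, \<open>p\<close> the current node and \<open>l\<close> the last one, which
  \<open>walk_start\<close> chooses as the predecessor of the starting node. The displaced value
  \<open>t l\<close> stays parked at \<open>p\<close>; once \<open>p = l\<close>, the defects of
  \<open>z\<close> and \<open>y\<close> vanish together.\<close>

definition walk_inv :: "'a set \<Rightarrow> ('a \<Rightarrow> 'a) \<Rightarrow> ('a \<Rightarrow> 'a) \<Rightarrow> 'a set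
    \<Rightarrow> ('a \<Rightarrow> 'a) \<Rightarrow> ('a \<Rightarrow> 'a) \<Rightarrow> 'a \<Rightarrow> 'a \<Rightarrow> bool" where
  "walk_inv A s t D z y p l \<longleftrightarrow> 
     z permutes A \<and> y permutes A \<and> p \<in> A \<and> l \<in> A \<and> D \<subseteq> A \<and> p \<notin> D \<and>
     (\<forall>x\<in>D. z x = t x \<and> y x = s x) \<and> (\<forall>x. x \<notin> D \<and> x \<noteq> p \<longrightarrow> z x = s x) \<and>
     (\<forall>x. x \<notin> D \<and> x \<noteq> l \<longrightarrow> y x = t x) \<and> y l = s p \<and> z p = t l"

context perm_pair
begin

lemma walk_inv_start:
  assumes "a \<in> A" shows "walk_inv A s t {} s t a (inv t (s a))"
proof -
  have "t (inv t (s a)) = s a" using t by (simp add: permutes_inverses)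
  moreover have "inv t (s a) \<in> A" using assms s t
    by (simp add: permutes_in_image permutes_inv)
  ultimately show ?thesis using assms s t by (simp add: walk_inv_def)
qed

text \<open>Put \<open>q = inv z (y p)\<close>. Since \<open>y p = t p\<close>, injectivity keeps
  \<open>q\<close> out of \<open>D\<close>, where \<open>z\<close> is \<open>t\<close>, and away
  from \<open>p\<close>, where \<open>z\<close> has the value \<open>t l\<close>. So
  \<open>z q = s q\<close>, and \<open>q\<close> is the successor of \<open>p\<close> on the cycle,
  although it was read off from \<open>z\<close> and \<open>y\<close> alone.\<close>

lemma walk_inv_step:
  assumes I: "walk_inv A s t D z y p l" and pl: "p \<noteq> l"
  shows "walk_inv A s t (insert p D) (z \<circ> transpose p (inv z (y p))) (y \<circ> transpose p l) (inv z (y p)) l"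
    and "t p = s (inv z (y p))"
proof -
  define q where "q = inv z (y p)"
  have perm: "z permutes A" "y permutes A" and D: "D \<subseteq> A" "p \<notin> D" and mem: "p \<in> A" "l \<in> A"
    and zD: "\<And>x. x \<in> D \<Longrightarrow> z x = t x" and yD: "\<And>x. x \<in> D \<Longrightarrow> y x = s x"
    and zs: "\<And>x. x \<notin> D \<Longrightarrow> x \<noteq> p \<Longrightarrow> z x = s x" and yt: "\<And>x. x \<notin> D \<Longrightarrow> x \<noteq> l \<Longrightarrow> y x = t x"
    and yl: "y l = s p" and zp: "z p = t l"
    using I by (auto simp: walk_inv_def)
  have lD: "l \<notin> D" using inj_st yD yl D by (metis injD)
  have yp: "y p = t p" using yt D pl by blast
  have zq: "z q = t p" using perm by (simp add: q_def permutes_inverses yp)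
  have qA: "q \<in> A" using perm mem by (simp add: q_def permutes_in_image permutes_inv)
  have qD: "q \<notin> D" using zD zq D inj_st by (metis injD)
  have qp: "q \<noteq> p" using zp zq pl inj_st by (metis injD)
  have zqs: "z q = s q" using zs qD qp by blast
  then show "t p = s (inv z (y p))" using zq q_def by simp
  have zp': "z \<circ> transpose p q permutes A" "y \<circ> transpose p l permutes A"
    using perm mem qA by (auto intro!: permutes_compose permutes_swap_id)
  show "walk_inv A s t (insert p D) (z \<circ> transpose p (inv z (y p))) (y \<circ> transpose p l) (inv z (y p)) l"
    unfolding q_def[symmetric] walk_inv_def
  proof (intro conjI ballI allI impI; (elim conjE)?)
    fix x assume x: "x \<in> insert p D"
    show "(z \<circ> transpose p q) x = t x" "(y \<circ> transpose p l) x = s x"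
      using x zq qD lD zD yD yl D by (auto simp: transpose_def)
  next
    fix x assume "x \<notin> insert p D" "x \<noteq> q" then show "(z \<circ> transpose p q) x = s x"
      using zs by (auto simp: transpose_def)
  next
    fix x assume "x \<notin> insert p D" "x \<noteq> l" then show "(y \<circ> transpose p l) x = t x"
      using yt by (auto simp: transpose_def)
  next
    show "(y \<circ> transpose p l) l = s q" using zqs zq yp by simp
    show "(z \<circ> transpose p q) q = t l" using zp by simp
  qed (use zp' qA mem D qD qp in auto)
qed

text \<open>The last conjunct forces termination: an unfinished walk has converted one new node per
  step, and \<open>D\<close> is a proper subset of \<open>A\<close>.\<close>

lemma walk_reaches:
  assumes "finite A" "a \<in> A"
  shows "\<exists>D z y p l. walk a (s, t) k = (z, y, p, l) \<and> walk_inv A s t D z y p l \<and> 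
      D \<union> {p} \<subseteq> bal_hull A (s, t) {a} \<and> a \<in> D \<union> {p} \<and> (p \<noteq> l \<longrightarrow> card D = k)"
proof (induction k)
  case 0
  have "a \<in> bal_hull A (s, t) {a}" by (auto simp: bal_hull_def)
  then show ?case using walk_inv_start[OF assms(2)] by (force simp: walk_def)
next
  case (Suc k)
  then obtain D z y p l where w: "walk a (s, t) k = (z, y, p, l)" and I: "walk_inv A s t D z y p l"
    and D: "D \<union> {p} \<subseteq> bal_hull A (s, t) {a}" "a \<in> D \<union> {p}" "p \<noteq> l \<longrightarrow> card D = k" by blast
  have w': "walk a (s, t) (Suc k) = walk_step (z, y, p, l)" using w by (simp add: walk_def)
  show ?case
  proof (cases "p = l")
    case True
    then show ?thesis using w' I D by auto
  next
    case False
    let ?q = "inv z (y p)"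
    have q: "t p = s ?q" by (rule walk_inv_step(2)[OF I False])
    have "s ?q \<in> t ` bal_hull A (s, t) {a}" using q D by (metis Un_iff imageI insertI1 subsetD)
    then have "s ?q \<in> s ` bal_hull A (s, t) {a}"
      using balanced_hull[of "{a}"] assms by (simp add: balanced_def)
    then have "?q \<in> bal_hull A (s, t) {a}" using inj_st by (simp add: inj_image_mem_iff)
    moreover have "card (insert p D) = Suc k"
      using D False I finite_subset[OF _ assms(1)] by (auto simp: walk_inv_def)
    ultimately show ?thesis using w' False walk_inv_step(1)[OF I False] D by auto
  qed
qed

lemma walk_final:
  assumes "finite A" "a \<in> A" "card A \<le> k"
  shows "fst (walk a (s, t) k) = fst (flip A {a} (s, t))" 
    and "fst (snd (walk a (s, t) k)) = snd (flip A {a} (s, t))"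
proof -
  obtain D z y p l where w: "walk a (s, t) k = (z, y, p, l)" and I: "walk_inv A s t D z y p l"
    and D: "D \<union> {p} \<subseteq> bal_hull A (s, t) {a}" "a \<in> D \<union> {p}" "p \<noteq> l \<longrightarrow> card D = k"
    using walk_reaches[OF assms(1,2), of k] by blast
  have "card D < card A" using I assms(1) by (intro psubset_card_mono) (auto simp: walk_inv_def)
  then have pl: "p = l" using D assms by auto
  let ?D = "D \<union> {p}"
  have in_D: "z x = t x" "y x = s x" if "x \<in> ?D" for x using that I pl by (auto simp: walk_inv_def)
  have out_D: "z x = s x" "y x = t x" if "x \<notin> ?D" for x using that I pl by (auto simp: walk_inv_def)
  have DA: "?D \<subseteq> A" using I by (auto simp: walk_inv_def)
  have z: "z permutes A" using I by (simp add: walk_inv_def)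
  \<comment> \<open>\<open>z\<close> is a permutation that equals \<open>t\<close> on
    \<open>?D\<close> and \<open>s\<close> off it, so comparing complements shows that
    \<open>s\<close> and \<open>t\<close> have the same image on \<open>?D\<close>. Being balanced,
    inside the hull and containing \<open>a\<close>, \<open>?D\<close> is the hull.\<close>
  have "t ` ?D = z ` ?D" using in_D by force
  also have "\<dots> = z ` (A - (A - ?D))" using DA by (simp add: double_diff)
  also have "\<dots> = A - z ` (A - ?D)"
    using permutes_inj[OF z] by (subst image_set_diff) (auto simp: permutes_image[OF z])
  also have "z ` (A - ?D) = s ` (A - ?D)" using out_D by force
  also have "A - s ` (A - ?D) = s ` (A - (A - ?D))"
    using inj_st by (subst image_set_diff) (auto simp: permutes_image[OF s])
  also have "A - (A - ?D) = ?D" using DA by (simp add: double_diff)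
  finally have "balanced A (s, t) ?D" using DA by (simp add: balanced_def)
  then have "bal_hull A (s, t) {a} = ?D" using D hull_least by blast
  then show "fst (walk a (s, t) k) = fst (flip A {a} (s, t))" 
    and "fst (snd (walk a (s, t) k)) = snd (flip A {a} (s, t))"
    using w in_D out_D by (auto simp: flip_def exchange_def fun_eq_iff)
qed

end


section \<open>Congestion of the walks and the Poincare inequality for perfect matchings\<close>

definition perfect :: "'a set \<Rightarrow> ('a \<Rightarrow> 'a \<Rightarrow> bool) \<Rightarrow> ('a \<Rightarrow> 'a) set" where
  "perfect A good = {z. z permutes A \<and> (\<forall>a\<in>A. good a (z a))}"

definition near_perfect :: "'a set \<Rightarrow> ('a \<Rightarrow> 'a \<Rightarrow> bool) \<Rightarrow> ('a \<Rightarrow> 'a) set" where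
  "near_perfect A good = {z. z permutes A \<and> (\<exists>p\<in>A. \<forall>a\<in>A-{p}. good a (z a))}"

text \<open>The unnormalised Dirichlet form of random transpositions restricted to
  \<open>N\<close>.\<close>

definition transposition_energy :: "'a set \<Rightarrow> ('a \<Rightarrow> 'a) set \<Rightarrow> (('a \<Rightarrow> 'a) \<Rightarrow> real) \<Rightarrow> real" where
  "transposition_energy A N F = (\<Sum>z\<in>N. \<Sum>p\<in>A. \<Sum>q\<in>A. 
     if z \<circ> transpose p q \<in> N then (F z - F (z \<circ> transpose p q))\<^sup>2 else 0)"

lemma walk_Suc: "walk a st (Suc k) = walk_step (walk a st k)"
  by (simp add: walk_def)

context
  fixes A :: "'a set" and good :: "'a \<Rightarrow> 'a \<Rightarrow> bool"
  assumes fin: "finite A"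
begin

lemma finite_perfect: "finite (perfect A good)" "finite (near_perfect A good)"
  by (auto simp: perfect_def near_perfect_def intro: finite_subset[OF _ finite_permutations[OF fin]])

lemma perm_pair_perfect: "s \<in> perfect A good \<Longrightarrow> t \<in> perfect A good \<Longrightarrow> perm_pair A s t"
  by (simp add: perfect_def perm_pair_def)

lemma flip_perfect:
  assumes "st \<in> perfect A good \<times> perfect A good" "S \<subseteq> A"
  shows "flip A S st \<in> perfect A good \<times> perfect A good"
proof -
  obtain s t where st: "st = (s, t)" "s \<in> perfect A good" "t \<in> perfect A good"
    using assms by auto
  interpret perm_pair A s t using st perm_pair_perfect by auto
  have "fst (flip A S (s, t)) permutes A" "snd (flip A S (s, t)) permutes A"
    using exchange_permutes[OF balanced_hull[OF assms(2)]] by (simp_all add: flip_def)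
  then show ?thesis using st by (auto simp: flip_def exchange_def perfect_def)
qed

lemma flip_flip:
  assumes "st \<in> perfect A good \<times> perfect A good" "S \<subseteq> A"
  shows "flip A S (flip A S st) = st"
  using assms flip_involution[of "fst st" A "snd st" S] by (auto simp: perfect_def)

lemma bij_betw_flip:
  assumes "S \<subseteq> A"
  shows "bij_betw (flip A S) (perfect A good \<times> perfect A good) (perfect A good \<times> perfect A good)"
  using flip_flip[OF _ assms] flip_perfect[OF _ assms]
  by (intro bij_betw_byWitness[where f' = "flip A S"] ballI image_subsetI) blast+

lemma walk_near_perfect:
  assumes "st \<in> perfect A good \<times> perfect A good" "a \<in> A"
  shows "walk a st k \<in> near_perfect A good \<times> near_perfect A good \<times> A \<times> A"
proof -
  obtain s t where st: "st = (s, t)" "s \<in> perfect A good" "t \<in> perfect A good"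
    using assms by auto
  interpret perm_pair A s t using st perm_pair_perfect by auto
  obtain D z y p l where w: "walk a st k = (z, y, p, l)" and I: "walk_inv A s t D z y p l"
    using walk_reaches[OF fin assms(2), of k] st by blast
  have z: "z x = s x \<or> z x = t x" if "x \<noteq> p" for x using I that by (auto simp: walk_inv_def)
  have y: "y x = s x \<or> y x = t x" if "x \<noteq> l" for x using I that by (auto simp: walk_inv_def)
  have "\<forall>x\<in>A-{p}. good x (z x)" "\<forall>x\<in>A-{l}. good x (y x)"
    using st(2,3) z y unfolding perfect_def by (metis (mono_tags, lifting) DiffE insertI1 mem_Collect_eq)+
  then show ?thesis using w I by (auto simp: near_perfect_def walk_inv_def)
qed

text \<open>Decoding: running the remaining steps from the intermediate state produces the flipped
  pair, and flipping the same cycle again restores the original one.\<close>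

lemma walk_inj:
  assumes "a \<in> A" "k \<le> card A"
  shows "inj_on (\<lambda>st. walk a st k) (perfect A good \<times> perfect A good)"
proof (rule inj_on_inverseI[where g = "\<lambda>x. flip A {a} (let w = (walk_step ^^ (card A - k)) x in (fst w, fst (snd w)))"])
  fix st assume st: "st \<in> perfect A good \<times> perfect A good"
  interpret perm_pair A "fst st" "snd st" using st perm_pair_perfect by auto
  have "(walk_step ^^ (card A - k)) (walk a st k) = walk a st (card A)"
    using assms by (simp add: walk_def funpow_add[symmetric, unfolded comp_def, THEN fun_cong] flip: funpow_add)
  moreover have "(fst (walk a st (card A)), fst (snd (walk a st (card A)))) = flip A {a} st"
    using walk_final[OF fin assms(1) order_refl] by (simp add: prod_eq_iff)
  ultimately show "flip A {a} (let w = (walk_step ^^ (card A - k)) (walk a st k) in (fst w, fst (snd w))) = st"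
    using flip_flip[OF st, of "{a}"] assms(1) by (simp add: Let_def)
qed

text \<open>The congestion bound. A state determines its next transposition, and distinct pairs are
  in distinct states at time \<open>k\<close>, so the sum over pairs is at most a sum over all
  conceivable states. There \<open>y\<close> and \<open>l\<close> are free and cost
  \<open>card (near_perfect A good)\<close> and \<open>card A\<close>.\<close>

lemma walk_energy:
  fixes F :: "('a \<Rightarrow> 'a) \<Rightarrow> real"
  assumes "a \<in> A" "k \<le> card A"
  shows "(\<Sum>st\<in>perfect A good \<times> perfect A good. (F (fst (walk a st k)) - F (fst (walk a st (Suc k))))\<^sup>2)
    \<le> real (card (near_perfect A good)) * real (card A) * transposition_energy A (near_perfect A good) F"
proof -
  let ?M = "perfect A good" and ?N = "near_perfect A good"
  define e where "e = (\<lambda>z p q. if z \<circ> transpose p q \<in> ?N then (F z - F (z \<circ> transpose p q))\<^sup>2 else 0)"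
  define h where "h = (\<lambda>(z, y, p, l :: 'a). e z p (inv z (y p)))"
  have e0: "0 \<le> e z p q" for z p q by (simp add: e_def)
  have step: "(F (fst (walk a st k)) - F (fst (walk a st (Suc k))))\<^sup>2 \<le> h (walk a st k)" 
    if st: "st \<in> ?M \<times> ?M" for st
  proof -
    obtain z y p l where w: "walk a st k = (z, y, p, l)" by (cases "walk a st k")
    have "fst (walk a st (Suc k)) \<in> ?N" using walk_near_perfect[OF st assms(1), of "Suc k"] by auto
    then show ?thesis using e0 by (auto simp: h_def w walk_Suc e_def split: if_splits)
  qed
  have "(\<Sum>st\<in>?M \<times> ?M. (F (fst (walk a st k)) - F (fst (walk a st (Suc k))))\<^sup>2)
      \<le> (\<Sum>st\<in>?M \<times> ?M. h (walk a st k))"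
    using step by (intro sum_mono)
  also have "\<dots> = (\<Sum>w\<in>(\<lambda>st. walk a st k) ` (?M \<times> ?M). h w)"
    using walk_inj[OF assms] by (simp add: sum.reindex)
  also have "\<dots> \<le> (\<Sum>w\<in>?N \<times> ?N \<times> A \<times> A. h w)"
  proof (rule sum_mono2)
    show "(\<lambda>st. walk a st k) ` (?M \<times> ?M) \<subseteq> ?N \<times> ?N \<times> A \<times> A"
      using walk_near_perfect[OF _ assms(1)] by blast
  qed (use e0 finite_perfect fin in \<open>auto simp: h_def\<close>)
  also have "\<dots> = (\<Sum>z\<in>?N. \<Sum>y\<in>?N. \<Sum>p\<in>A. \<Sum>l\<in>A. e z p (inv z (y p)))"
    by (simp add: h_def sum.cartesian_product del: sum_constant)
  also have "\<dots> \<le> (\<Sum>z\<in>?N. \<Sum>y\<in>?N. \<Sum>p\<in>A. \<Sum>l\<in>A. \<Sum>q\<in>A. e z p q)"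
  proof (intro sum_mono)
    fix z y p assume z: "z \<in> ?N" "y \<in> ?N" and p: "p \<in> A"
    have "inv z (y p) \<in> A" using z p by (simp add: near_perfect_def permutes_in_image permutes_inv)
    then show "e z p (inv z (y p)) \<le> (\<Sum>q\<in>A. e z p q)"
      using e0 fin by (intro member_le_sum) auto
  qed
  also have "\<dots> = (\<Sum>z\<in>?N. real (card ?N) * real (card A) * (\<Sum>p\<in>A. \<Sum>q\<in>A. e z p q))"
    by (simp add: sum_distrib_left mult.assoc)
  also have "\<dots> = real (card ?N) * real (card A) * transposition_energy A ?N F"
    by (simp add: sum_distrib_left transposition_energy_def e_def)
  finally show ?thesis .
qed

text \<open>Of the three factors \<open>card A\<close>, one is the Cauchy-Schwarz price of
  telescoping, one the number of steps, and one comes from \<open>walk_energy\<close>.\<close>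

lemma flip_energy:
  fixes F :: "('a \<Rightarrow> 'a) \<Rightarrow> real"
  assumes "a \<in> A"
  shows "(\<Sum>st\<in>perfect A good \<times> perfect A good. (F (fst st) - F (fst (flip A {a} st)))\<^sup>2)
    \<le> real (card A) ^ 3 * real (card (near_perfect A good)) * transposition_energy A (near_perfect A good) F"
proof -
  let ?M = "perfect A good" and ?N = "near_perfect A good"
  have "(F (fst st) - F (fst (flip A {a} st)))\<^sup>2 \<le> real (card A) * 
      (\<Sum>k<card A. (F (fst (walk a st k)) - F (fst (walk a st (Suc k))))\<^sup>2)" if st: "st \<in> ?M \<times> ?M" for st
  proof -
    interpret perm_pair A "fst st" "snd st" using st perm_pair_perfect by auto
    have "fst (walk a st 0) = fst st" by (cases st) (simp add: walk_def)
    moreover have "fst (walk a st (card A)) = fst (flip A {a} st)"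
      using walk_final(1)[OF fin assms order_refl] by simp
    ultimately show ?thesis using telescope_square_le[of "\<lambda>k. F (fst (walk a st k))" "card A"] by simp
  qed
  then have "(\<Sum>st\<in>?M \<times> ?M. (F (fst st) - F (fst (flip A {a} st)))\<^sup>2)
    \<le> (\<Sum>st\<in>?M \<times> ?M. real (card A) * (\<Sum>k<card A. (F (fst (walk a st k)) - F (fst (walk a st (Suc k))))\<^sup>2))"
    by (intro sum_mono)
  also have "\<dots> = real (card A) * (\<Sum>k<card A. \<Sum>st\<in>?M \<times> ?M. (F (fst (walk a st k)) - F (fst (walk a st (Suc k))))\<^sup>2)"
    unfolding sum_distrib_left[symmetric] by (subst sum.swap) simp
  also have "\<dots> \<le> real (card A) * (\<Sum>k<card A. real (card ?N) * real (card A) * transposition_energy A ?N F)"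
    using walk_energy[OF assms] by (intro mult_left_mono sum_mono) auto
  finally show ?thesis by (simp add: power3_eq_cube mult_ac)
qed

text \<open>The nodes are taken in a fixed order, and each round flips the cycle of the next node
  unless this has been done already. After the last round the first component is \<open>t\<close>.
  Telescoping over the rounds adds two more factors \<open>card A\<close> to those of
  \<open>flip_energy\<close>.\<close>

theorem perfect_variance_le_energy:
  fixes F :: "('a \<Rightarrow> 'a) \<Rightarrow> real"
  shows "(\<Sum>s\<in>perfect A good. \<Sum>t\<in>perfect A good. (F s - F t)\<^sup>2)
    \<le> real (card A) ^ 5 * real (card (near_perfect A good)) * transposition_energy A (near_perfect A good) F"
proof -
  let ?M = "perfect A good" and ?N = "near_perfect A good"
  define B where "B = real (card A) ^ 3 * real (card ?N) * transposition_energy A ?N F"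
  have B0: "0 \<le> B" by (auto simp: B_def transposition_energy_def intro!: mult_nonneg_nonneg sum_nonneg)
  obtain e where e: "bij_betw e {0..<card A} A" using ex_bij_betw_nat_finite[OF fin] by auto
  define S where "S = (\<lambda>r. e ` {..<r})"
  have SA: "S r \<subseteq> A" if "r \<le> card A" for r
    using that e by (auto simp: S_def bij_betw_def)
  have S_Suc: "S (Suc r) = insert (e r) (S r)" for r by (auto simp: S_def lessThan_Suc)
  have S_card: "S (card A) = A" using e by (auto simp: S_def bij_betw_def lessThan_atLeast0)
  have round: "(\<Sum>st\<in>?M \<times> ?M. (F (fst (flip A (S r) st)) - F (fst (flip A (S (Suc r)) st)))\<^sup>2) \<le> B"
    if r: "r < card A" for r
  proof -
    have er: "e r \<in> A" using e r by (auto simp: bij_betw_def)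
    have le: "(F (fst (flip A (S r) st)) - F (fst (flip A (S (Suc r)) st)))\<^sup>2 \<le>
       (F (fst (flip A (S r) st)) - F (fst (flip A {e r} (flip A (S r) st))))\<^sup>2" if st: "st \<in> ?M \<times> ?M" for st
    proof -
      interpret perm_pair A "fst st" "snd st" using st perm_pair_perfect by auto
      have Sr: "S r \<subseteq> A" using SA r by simp
      show ?thesis
      proof (cases "e r \<in> bal_hull A st (S r)")
        case True
        then have "bal_hull A st (S (Suc r)) = bal_hull A st (S r)"
          using hull_insert_in[OF Sr, of "e r"] by (simp add: S_Suc)
        then show ?thesis by (simp add: flip_def)
      next
        \<comment> \<open>The cycle of \<open>e r\<close> is disjoint from the flipped ones, and
          these flips did not change it, so flipping it now leads exactly to the next stage.\<close>
        case False
        have "bal_hull A (flip A (S r) st) {e r} = bal_hull A st {e r}"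
          using hull_exchange[OF s t balanced_hull[OF Sr]] by (simp add: flip_def)
        then have "flip A {e r} (flip A (S r) st) = flip A (S (Suc r)) st"
          using hull_insert_notin[OF Sr er] False by (simp add: flip_def exchange_disjoint S_Suc)
        then show ?thesis by simp
      qed
    qed
    have "(\<Sum>st\<in>?M \<times> ?M. (F (fst (flip A (S r) st)) - F (fst (flip A (S (Suc r)) st)))\<^sup>2)
      \<le> (\<Sum>st\<in>?M \<times> ?M. (F (fst (flip A (S r) st)) - F (fst (flip A {e r} (flip A (S r) st))))\<^sup>2)"
      using le by (intro sum_mono)
    \<comment> \<open>The preceding rounds together permute the set of all pairs, so on average
      round \<open>r\<close> costs as much as flipping one cycle of a fresh pair.\<close>
    also have "\<dots> = (\<Sum>st\<in>?M \<times> ?M. (F (fst st) - F (fst (flip A {e r} st)))\<^sup>2)"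
      using sum.reindex_bij_betw[OF bij_betw_flip, of "S r" "\<lambda>st. (F (fst st) - F (fst (flip A {e r} st)))\<^sup>2"] 
        SA r by simp
    also have "\<dots> \<le> B" unfolding B_def by (rule flip_energy[OF er])
    finally show ?thesis .
  qed
  have path: "(F (fst st) - F (snd st))\<^sup>2 \<le> real (card A) * 
      (\<Sum>r<card A. (F (fst (flip A (S r) st)) - F (fst (flip A (S (Suc r)) st)))\<^sup>2)"
    if st: "st \<in> ?M \<times> ?M" for st
  proof -
    interpret perm_pair A "fst st" "snd st" using st perm_pair_perfect by auto
    have "bal_hull A st {} = {}" using hull_least[of "{}" "{}"] by (simp add: balanced_def)
    then have 0: "fst (flip A (S 0) st) = fst st" by (simp add: S_def flip_def exchange_def)
    have "bal_hull A st A = A" using hull_least[OF balanced_full order_refl] hull_superset[of A] by simp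
    then have 1: "fst (flip A (S (card A)) st) = snd st"
      using s t by (auto simp: S_card flip_def exchange_def fun_eq_iff permutes_not_in)
    show ?thesis
      using telescope_square_le[of "\<lambda>r. F (fst (flip A (S r) st))" "card A"] 0 1 by simp
  qed
  have "(\<Sum>s\<in>?M. \<Sum>t\<in>?M. (F s - F t)\<^sup>2) = (\<Sum>st\<in>?M \<times> ?M. (F (fst st) - F (snd st))\<^sup>2)"
    by (simp add: sum.cartesian_product case_prod_beta)
  also have "\<dots> \<le> (\<Sum>st\<in>?M \<times> ?M. real (card A) * 
      (\<Sum>r<card A. (F (fst (flip A (S r) st)) - F (fst (flip A (S (Suc r)) st)))\<^sup>2))"
    using path by (intro sum_mono)
  also have "\<dots> = real (card A) * (\<Sum>r<card A. 
      \<Sum>st\<in>?M \<times> ?M. (F (fst (flip A (S r) st)) - F (fst (flip A (S (Suc r)) st)))\<^sup>2)"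
    unfolding sum_distrib_left[symmetric] by (subst sum.swap) simp
  also have "\<dots> \<le> real (card A) * (\<Sum>r<card A. B)"
    using round by (intro mult_left_mono sum_mono) auto
  also have "\<dots> = real (card A) ^ 5 * real (card ?N) * transposition_energy A ?N F"
    by (simp add: B_def eval_nat_numeral mult_ac)
  finally show ?thesis .
qed

end

section \<open>Lazy symmetric Markov chains\<close>

locale lazy_symmetric_chain =
  fixes R :: "'a set" and P :: "'a \<Rightarrow> 'a \<Rightarrow> real"
  assumes fin: "finite R" and ne: "R \<noteq> {}"
    and sym: "\<And>x y. x \<in> R \<Longrightarrow> y \<in> R \<Longrightarrow> P x y = P y x"
    and nonneg: "\<And>x y. x \<in> R \<Longrightarrow> y \<in> R \<Longrightarrow> 0 \<le> P x y"
    and row: "\<And>x. x \<in> R \<Longrightarrow> (\<Sum>y\<in>R. P x y) = 1"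
    and lazy: "\<And>x. x \<in> R \<Longrightarrow> 1 / 2 \<le> P x x"
begin

definition dirichlet :: "('a \<Rightarrow> real) \<Rightarrow> real" where
  "dirichlet h = (\<Sum>x\<in>R. \<Sum>y\<in>R. P x y * (h x - h y)\<^sup>2) / 2"

definition push :: "('a \<Rightarrow> real) \<Rightarrow> 'a \<Rightarrow> real" where
  "push h x = (\<Sum>y\<in>R. h y * P y x)"

lemma column: "x \<in> R \<Longrightarrow> (\<Sum>y\<in>R. P y x) = 1"
proof -
  assume x: "x \<in> R"
  then have "(\<Sum>y\<in>R. P y x) = (\<Sum>y\<in>R. P x y)" by (intro sum.cong sym) auto
  then show ?thesis using row[OF x] by simp
qed

lemma dirichlet_eq: "dirichlet h = (\<Sum>x\<in>R. (h x)\<^sup>2) - (\<Sum>x\<in>R. h x * push h x)"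
proof -
  have "2 * dirichlet h = (\<Sum>x\<in>R. \<Sum>y\<in>R. P x y * (h x)\<^sup>2) + (\<Sum>x\<in>R. \<Sum>y\<in>R. P x y * (h y)\<^sup>2)
      - 2 * (\<Sum>x\<in>R. \<Sum>y\<in>R. h x * (h y * P x y))"
    unfolding dirichlet_def
    by (simp add: power2_eq_square algebra_simps sum_distrib_left flip: sum.distrib sum_subtractf)
  also have "(\<Sum>x\<in>R. \<Sum>y\<in>R. P x y * (h x)\<^sup>2) = (\<Sum>x\<in>R. (h x)\<^sup>2)"
    by (simp add: row flip: sum_distrib_right)
  also have "(\<Sum>x\<in>R. \<Sum>y\<in>R. P x y * (h y)\<^sup>2) = (\<Sum>x\<in>R. (h x)\<^sup>2)"
    by (subst sum.swap) (simp add: column flip: sum_distrib_right)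
  also have "(\<Sum>x\<in>R. \<Sum>y\<in>R. h x * (h y * P x y)) = (\<Sum>x\<in>R. h x * push h x)"
    unfolding push_def sum_distrib_left using sym by (intro sum.cong) auto
  finally show ?thesis by simp
qed

text \<open>Laziness makes \<open>2 P - I\<close> stochastic, and hence \<open>P - P\<^sup>2 = (I - (2 P - I)\<^sup>2) / 4\<close> positive semidefinite.\<close>

lemma push_contracts: "(\<Sum>x\<in>R. (push h x)\<^sup>2) \<le> (\<Sum>x\<in>R. (h x)\<^sup>2) - dirichlet h"
proof -
  define Q where "Q = (\<lambda>y x. 2 * P y x - (if y = x then 1 else 0))"
  have Q0: "0 \<le> Q y x" if "y \<in> R" "x \<in> R" for x y
    using nonneg[OF that] lazy[OF that(2)] by (simp add: Q_def)
  have Q1: "(\<Sum>y\<in>R. Q y x) = 1" "(\<Sum>y\<in>R. Q x y) = 1" if "x \<in> R" for x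
    unfolding Q_def sum_subtractf sum_distrib_left[symmetric] row[OF that] column[OF that]
    using that fin by simp_all
  have "(2 * push h x - h x)\<^sup>2 \<le> (\<Sum>y\<in>R. Q y x * (h y)\<^sup>2)" if x: "x \<in> R" for x
  proof -
    have "2 * push h x - h x = (\<Sum>y\<in>R. 2 * (h y * P y x)) - (\<Sum>y\<in>R. if y = x then h y else 0)"
      using x fin by (simp add: push_def sum_distrib_left)
    also have "\<dots> = (\<Sum>y\<in>R. Q y x * h y)"
      unfolding sum_subtractf[symmetric] Q_def by (intro sum.cong) (auto simp: algebra_simps)
    finally show ?thesis
      using weighted_sum_square_le[of R "\<lambda>y. Q y x" h] Q0 Q1 x by simp
  qed
  then have "(\<Sum>x\<in>R. (2 * push h x - h x)\<^sup>2) \<le> (\<Sum>x\<in>R. \<Sum>y\<in>R. Q y x * (h y)\<^sup>2)"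
    by (intro sum_mono)
  also have "\<dots> = (\<Sum>y\<in>R. (h y)\<^sup>2)"
    by (subst sum.swap) (simp add: Q1 flip: sum_distrib_right)
  finally have "(\<Sum>x\<in>R. (2 * push h x - h x)\<^sup>2) \<le> (\<Sum>x\<in>R. (h x)\<^sup>2)" .
  moreover have "(\<Sum>x\<in>R. (2 * push h x - h x)\<^sup>2) = 
      (\<Sum>x\<in>R. 4 * (push h x)\<^sup>2 - 4 * (h x * push h x) + (h x)\<^sup>2)"
    by (intro sum.cong) (auto simp: power2_eq_square algebra_simps)
  ultimately have "4 * (\<Sum>x\<in>R. (push h x)\<^sup>2) - 4 * (\<Sum>x\<in>R. h x * push h x) \<le> 0"
    by (simp add: sum.distrib sum_subtractf flip: sum_distrib_left)
  then show ?thesis by (simp add: dirichlet_eq)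
qed

text \<open>The deviation from uniform has sum 0 at all times, so the Poincare inequality applies to
  it. By \<open>push_contracts\<close> a step lowers its squared norm by at least its Dirichlet
  form, hence by the factor \<open>1 - lam\<close>; a point mass starts at
  \<open>1 - 1 / N\<close>.\<close>

lemma l2_decay:
  fixes p :: "nat \<Rightarrow> 'a \<Rightarrow> real"
  assumes lam: "lam \<le> 1"
    and poincare: "\<And>h. (\<Sum>x\<in>R. h x) = 0 \<Longrightarrow> lam * (\<Sum>x\<in>R. (h x)\<^sup>2) \<le> dirichlet h"
    and p0: "\<And>x. x \<in> R \<Longrightarrow> p 0 x = (if x = g then 1 else 0)" and g: "g \<in> R"
    and pS: "\<And>t x. x \<in> R \<Longrightarrow> p (Suc t) x = (\<Sum>y\<in>R. p t y * P y x)"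
  shows "(\<Sum>x\<in>R. (p t x - 1 / real (card R))\<^sup>2) \<le> (1 - lam) ^ t"
proof -
  define N where "N = real (card R)"
  have N: "N > 0" using fin ne by (simp add: N_def card_gt_0_iff)
  have total: "(\<Sum>x\<in>R. p t x) = 1" for t
  proof (induction t)
    case 0 then show ?case using fin g by (simp add: p0)
  next
    case (Suc t)
    have "(\<Sum>x\<in>R. p (Suc t) x) = (\<Sum>y\<in>R. \<Sum>x\<in>R. p t y * P y x)"
      by (subst sum.swap) (simp add: pS)
    then show ?case using Suc by (simp add: row flip: sum_distrib_left)
  qed
  have mean: "(\<Sum>x\<in>R. p t x - 1 / N) = 0" for t using total N by (simp add: sum_subtractf N_def)
  have "(\<Sum>x\<in>R. (p t x - 1 / N)\<^sup>2) \<le> (1 - lam) ^ t"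
  proof (induction t)
    case 0
    have "(\<Sum>x\<in>R. (p 0 x - 1 / N)\<^sup>2) = (\<Sum>x\<in>R. (if x = g then 1 - 2 / N else 0) + 1 / N\<^sup>2)"
      using N by (intro sum.cong) (auto simp: p0 power2_eq_square field_simps)
    also have "\<dots> = 1 - 2 / N + N * (1 / N\<^sup>2)" using fin g by (simp add: sum.distrib N_def)
    also have "\<dots> = 1 - 1 / N" using N by (simp add: power2_eq_square field_simps)
    finally show ?case using N by simp
  next
    case (Suc t)
    let ?h = "\<lambda>x. p t x - 1 / N"
    have "p (Suc t) x - 1 / N = push ?h x" if "x \<in> R" for x
      using column[OF that] that by (simp add: pS push_def left_diff_distrib sum_subtractf flip: sum_divide_distrib)
    then have "(\<Sum>x\<in>R. (p (Suc t) x - 1 / N)\<^sup>2) = (\<Sum>x\<in>R. (push ?h x)\<^sup>2)" by simp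
    also have "\<dots> \<le> (\<Sum>x\<in>R. (?h x)\<^sup>2) - dirichlet ?h" by (rule push_contracts)
    also have "\<dots> \<le> (1 - lam) * (\<Sum>x\<in>R. (?h x)\<^sup>2)"
      using poincare[of ?h] mean by (simp add: left_diff_distrib)
    also have "\<dots> \<le> (1 - lam) * (1 - lam) ^ t" using Suc lam by (intro mult_left_mono) auto
    finally show ?case by simp
  qed
  then show ?thesis by (simp add: N_def)
qed

text \<open>Passing from the squared norm to the l1 norm costs a factor \<open>card R\<close>, so
  the squared norm has to fall below \<open>eps\<^sup>2 / real (card R)\<close>; this is where the
  required time comes from. The sum bounded here is twice the total variation distance.\<close>

lemma total_variation_le:
  fixes p :: "nat \<Rightarrow> 'a \<Rightarrow> real"
  assumes lam: "0 < lam" "lam \<le> 1" and eps: "0 < eps"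
    and poincare: "\<And>h. (\<Sum>x\<in>R. h x) = 0 \<Longrightarrow> lam * (\<Sum>x\<in>R. (h x)\<^sup>2) \<le> dirichlet h"
    and p0: "\<And>x. x \<in> R \<Longrightarrow> p 0 x = (if x = g then 1 else 0)" and g: "g \<in> R"
    and pS: "\<And>t x. x \<in> R \<Longrightarrow> p (Suc t) x = (\<Sum>y\<in>R. p t y * P y x)"
    and t: "(ln (real (card R)) + 2 * ln (1 / eps)) / lam \<le> real t"
  shows "(\<Sum>x\<in>R. \<bar>p t x - 1 / real (card R)\<bar>) \<le> eps"
proof -
  have N: "real (card R) > 0" using fin ne by (simp add: card_gt_0_iff)
  have "(1 - lam) ^ t \<le> exp (- lam) ^ t"
    using lam exp_ge_add_one_self[of "- lam"] by (intro power_mono) auto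
  also have "\<dots> = exp (- (lam * real t))" by (simp add: mult.commute flip: exp_of_nat_mult)
  also have "\<dots> \<le> exp (- (ln (real (card R)) + 2 * ln (1 / eps)))"
    using t lam by (simp add: field_simps)
  also have "\<dots> = eps\<^sup>2 / real (card R)"
  proof -
    have "exp (2 * ln (1 / eps)) = (1 / eps)\<^sup>2"
      using eps by (simp only: exp_double) (simp add: ln_div exp_minus divide_inverse)
    then show ?thesis using N eps by (simp add: exp_minus exp_add power_divide minus_add_distrib[symmetric] inverse_eq_divide del: minus_add_distrib)
  qed
  finally have decay: "(1 - lam) ^ t \<le> eps\<^sup>2 / real (card R)" .
  have "(\<Sum>x\<in>R. \<bar>p t x - 1 / real (card R)\<bar>)\<^sup>2 \<le> real (card R) * (\<Sum>x\<in>R. \<bar>p t x - 1 / real (card R)\<bar>\<^sup>2)"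
    by (rule sum_square_le_card)
  also have "\<dots> \<le> real (card R) * (1 - lam) ^ t"
    using l2_decay[OF lam(2) poincare p0 g pS, of t] by (intro mult_left_mono) auto
  also have "\<dots> \<le> real (card R) * (eps\<^sup>2 / real (card R))" using decay by (intro mult_left_mono) auto
  also have "\<dots> = eps\<^sup>2" using N by simp
  finally show ?thesis using eps by (auto intro: power2_le_imp_le)
qed

end

section \<open>Repairing degree defects\<close>

definition row_degree :: "(nat \<times> nat) set \<Rightarrow> nat \<Rightarrow> nat" where
  "row_degree H i = card {j. (i, j) \<in> H}"

definition col_degree :: "(nat \<times> nat) set \<Rightarrow> nat \<Rightarrow> nat" where
  "col_degree H j = card {i. (i, j) \<in> H}"

lemma mem_realizations:
  "G \<in> realizations n m du dv \<longleftrightarrow> G \<subseteq> {0..<n} \<times> {0..<m} \<and>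
     (\<forall>i<n. row_degree G i = du i) \<and> (\<forall>j<m. col_degree G j = dv j)"
  by (simp add: realizations_def row_degree_def col_degree_def)

lemma finite_row: "finite H \<Longrightarrow> finite {j. (i, j) \<in> H}"
  by (rule finite_subset[of _ "snd ` H"]) force+

lemma finite_col: "finite H \<Longrightarrow> finite {i. (i, j) \<in> H}"
  by (rule finite_subset[of _ "fst ` H"]) force+

lemma row_degree_insert:
  assumes "finite H" "(a, b) \<notin> H"
  shows "row_degree (insert (a, b) H) i = row_degree H i + of_bool (i = a)"
proof (cases "i = a")
  case True
  have "{j. (a, j) \<in> insert (a, b) H} = insert b {j. (a, j) \<in> H}" by auto
  then show ?thesis using True assms finite_row[of H a] by (simp add: row_degree_def)
qed (simp add: row_degree_def)

lemma col_degree_insert: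
  assumes "finite H" "(a, b) \<notin> H"
  shows "col_degree (insert (a, b) H) j = col_degree H j + of_bool (j = b)"
proof (cases "j = b")
  case True
  have "{i. (i, b) \<in> insert (a, b) H} = insert a {i. (i, b) \<in> H}" by auto
  then show ?thesis using True assms finite_col[of H b] by (simp add: col_degree_def)
qed (simp add: col_degree_def)

lemma row_degree_remove:
  assumes "finite H" "(a, b) \<in> H"
  shows "row_degree (H - {(a, b)}) i + of_bool (i = a) = row_degree H i"
  using row_degree_insert[of "H - {(a, b)}" a b i] assms by (simp add: insert_absorb)

lemma col_degree_remove:
  assumes "finite H" "(a, b) \<in> H"
  shows "col_degree (H - {(a, b)}) j + of_bool (j = b) = col_degree H j"
  using col_degree_insert[of "H - {(a, b)}" a b j] assms by (simp add: insert_absorb)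

lemma row_degree_converse [simp]: "row_degree (H\<inverse>) = col_degree H"
  by (simp add: row_degree_def col_degree_def fun_eq_iff)

lemma col_degree_converse [simp]: "col_degree (H\<inverse>) = row_degree H"
  by (simp add: row_degree_def col_degree_def fun_eq_iff)

lemma realizations_converse: "G \<in> realizations m n dv du \<Longrightarrow> G\<inverse> \<in> realizations n m du dv"
  by (auto simp: mem_realizations)

section \<open>Hamming distance between edge sets\<close>

definition hamming :: "'a set \<Rightarrow> 'a set \<Rightarrow> nat" where
  "hamming G H = card ((G - H) \<union> (H - G))"

lemma hamming_same [simp]: "hamming G G = 0"
  by (simp add: hamming_def)

lemma hamming_commute: "hamming G H = hamming H G"
  by (simp add: hamming_def Un_commute)

lemma hamming_triangle:
  assumes "finite G" "finite H" "finite K"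
  shows "hamming G K \<le> hamming G H + hamming H K"
  unfolding hamming_def by (rule order_trans[OF card_mono card_Un_le]) (use assms in auto)

lemma hamming_converse: "hamming (G\<inverse>) (H\<inverse>) = hamming G H"
proof -
  have "(G\<inverse> - H\<inverse>) \<union> (H\<inverse> - G\<inverse>) = ((G - H) \<union> (H - G))\<inverse>" by auto
  then show ?thesis by (simp add: hamming_def card_inverse)
qed

lemma hamming_le_cover:
  assumes "finite D" "G - D = H - D" "card D \<le> k"
  shows "hamming G H \<le> k"
proof -
  have "(G - H) \<union> (H - G) \<subseteq> D" using assms(2) by blast
  then show ?thesis using assms(1,3) card_mono unfolding hamming_def by (meson order_trans)
qed

lemma card_edges_by_row:
  assumes "finite U" "finite V"
  shows "card {e \<in> H. fst e \<in> U \<and> snd e \<in> V} = (\<Sum>u\<in>U. card {v \<in> V. (u, v) \<in> H})"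
proof -
  have "{e \<in> H. fst e \<in> U \<and> snd e \<in> V} = Sigma U (\<lambda>u. {v \<in> V. (u, v) \<in> H})" by auto
  then show ?thesis using assms by simp
qed

lemma card_edges_by_col:
  assumes "finite U" "finite V"
  shows "card {e \<in> H. fst e \<in> U \<and> snd e \<in> V} = (\<Sum>v\<in>V. card {u \<in> U. (u, v) \<in> H})"
proof -
  have "{e \<in> H. fst e \<in> U \<and> snd e \<in> V} = prod.swap ` Sigma V (\<lambda>v. {u \<in> U. (u, v) \<in> H})"
    by force
  then have "card {e \<in> H. fst e \<in> U \<and> snd e \<in> V} = card (Sigma V (\<lambda>v. {u \<in> U. (u, v) \<in> H}))"
    by (simp add: card_image)
  then show ?thesis using assms by simp
qed

text \<open>The inequality on the bounds is kept out, which makes this locale invariant under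
  exchanging the two classes. The repair argument uses only one alternative of the maximum; the
  other is reached by that exchange.\<close>

locale degree_bounds =
  fixes n m c1 c2 d1 d2 :: nat and du dv :: "nat \<Rightarrow> nat"
  assumes c: "0 < c1" "c1 \<le> c2" "c2 < n" and d: "0 < d1" "d1 \<le> d2" "d2 < m"
    and dv: "\<And>j. j < m \<Longrightarrow> c1 \<le> dv j \<and> dv j \<le> c2"
    and du: "\<And>i. i < n \<Longrightarrow> d1 \<le> du i \<and> du i \<le> d2"
begin

lemma degree_bounds_converse: "degree_bounds m n d1 d2 c1 c2 dv du"
  using c d dv du by unfold_locales auto

text \<open>If no augmenting path from \<open>u0\<close> to \<open>v0\<close> has length at most 7, the vertices reachable from \<open>u0\<close>
  form layers \<open>U1 \<subseteq> U2\<close> in the row class; double counting the edges at \<open>V2\<close>, whose vertices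
  have all their neighbours in \<open>U2\<close>, contradicts the inequality on the degree bounds.\<close>

lemma repair_deficit_aux:
  assumes cond: "(int c2 - int c1 - 1) * (int d2 - int d1 - 1) \<le> int c1 * (int m - int d2)"
    and H: "H \<subseteq> {0..<n} \<times> {0..<m}" and u0: "u0 < n" and v0: "v0 < m"
    and row: "\<And>i. i < n \<Longrightarrow> row_degree H i + of_bool (i = u0) = du i"
    and col: "\<And>j. j < m \<Longrightarrow> col_degree H j + of_bool (j = v0) = dv j"
  shows "\<exists>G\<in>realizations n m du dv. hamming H G \<le> 7"
proof (rule ccontr)
  assume no: "\<not> ?thesis"
  have fH: "finite H" by (rule finite_subset[OF H]) simp
  have Hmem: "u < n" "v < m" if "(u, v) \<in> H" for u v using H that by auto
  \<comment> \<open>Any correction of both deficits that alters at most 7 cells contradicts the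
    assumption.\<close>
  have stuck: False if G: "G \<subseteq> {0..<n} \<times> {0..<m}" "\<And>i. row_degree G i = row_degree H i + of_bool (i = u0)"
      "\<And>j. col_degree G j = col_degree H j + of_bool (j = v0)"
      "finite D" "H - D = G - D" "card D \<le> 7" for G D
    using no G row col hamming_le_cover[OF G(4,5,6)] by (auto simp: mem_realizations)
  \<comment> \<open>\<open>A1\<close>, \<open>A3\<close>, \<open>A5\<close> and \<open>A7\<close>
    exclude augmenting paths of these lengths from \<open>u0\<close> to \<open>v0\<close>: non-edges
    to be added alternate with edges to be removed.\<close>
  have A1: "(u0, v0) \<in> H"
  proof (rule ccontr)
    assume a: "(u0, v0) \<notin> H"
    show False
      by (rule stuck[of "insert (u0, v0) H" "{(u0, v0)}"])
         (use a H u0 v0 fH in \<open>auto simp: row_degree_insert col_degree_insert\<close>)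
  qed
  have A3: "(u1, v0) \<in> H" if e: "(u0, v1) \<notin> H" "(u1, v1) \<in> H" for u1 v1
  proof (rule ccontr)
    assume a: "(u1, v0) \<notin> H"
    let ?H1 = "H - {(u1, v1)}"
    have ne: "u0 \<noteq> u1" using e by auto
    show False
    proof (rule stuck[of "insert (u0, v1) (insert (u1, v0) ?H1)" "{(u0, v1), (u1, v0), (u1, v1)}"])
      fix x
      show "row_degree (insert (u0, v1) (insert (u1, v0) ?H1)) x = row_degree H x + of_bool (x = u0)"
        using e a fH ne row_degree_remove[OF fH e(2), of x] by (simp add: row_degree_insert)
      show "col_degree (insert (u0, v1) (insert (u1, v0) ?H1)) x = col_degree H x + of_bool (x = v0)"
        using e a fH ne col_degree_remove[OF fH e(2), of x] by (simp add: col_degree_insert)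
    next
      show "card {(u0, v1), (u1, v0), (u1, v1)} \<le> 7" 
        by (rule order_trans[OF card_length[of "[(u0, v1), (u1, v0), (u1, v1)]", simplified]]) simp
    qed (use e H u0 v0 Hmem in auto)
  qed
  have A5: "(u2, v0) \<in> H" if e: "(u0, v1) \<notin> H" "(u1, v1) \<in> H" "(u1, v2) \<notin> H" "(u2, v2) \<in> H" for u1 v1 u2 v2
  proof (rule ccontr)
    assume a: "(u2, v0) \<notin> H"
    let ?H1 = "H - {(u1, v1)}"
    let ?H2 = "?H1 - {(u2, v2)}"
    have ne: "u0 \<noteq> u1" "u1 \<noteq> u2" "u0 \<noteq> u2" using e a A1 by auto
    have e2: "(u2, v2) \<in> ?H1" using e ne by auto
    let ?D = "{(u0, v1), (u1, v2), (u2, v0), (u1, v1), (u2, v2)}"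
    let ?G = "insert (u0, v1) (insert (u1, v2) (insert (u2, v0) ?H2))"
    show False
    proof (rule stuck[of ?G ?D])
      fix x
      show "row_degree ?G x = row_degree H x + of_bool (x = u0)"
        using e a fH ne row_degree_remove[OF fH e(2), of x] row_degree_remove[OF _ e2, of x]
        by (simp add: row_degree_insert)
      show "col_degree ?G x = col_degree H x + of_bool (x = v0)"
        using e a fH ne col_degree_remove[OF fH e(2), of x] col_degree_remove[OF _ e2, of x]
        by (simp add: col_degree_insert)
    next
      show "card ?D \<le> 7" 
        by (rule order_trans[OF card_length[of "[(u0, v1), (u1, v2), (u2, v0), (u1, v1), (u2, v2)]", simplified]]) simp
    qed (use e H u0 v0 Hmem in auto)
  qed
  have A7: "(u3, v0) \<in> H" if e: "(u0, v1) \<notin> H" "(u1, v1) \<in> H" "(u1, v2) \<notin> H" "(u2, v2) \<in> H" 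
     "(u2, v3) \<notin> H" "(u3, v3) \<in> H" for u1 v1 u2 v2 u3 v3
  proof (rule ccontr)
    assume a: "(u3, v0) \<notin> H"
    let ?H1 = "H - {(u1, v1)}"
    let ?H2 = "?H1 - {(u2, v2)}"
    let ?H3 = "?H2 - {(u3, v3)}"
    \<comment> \<open>If row vertices coincide, a shorter path already augments. Coinciding columns
      do no harm, since the cells of the path remain distinct.\<close>
    have "u2 \<noteq> u0" using A3[of v3 u3] e a by auto
    then have ne: "u0 \<noteq> u1" "u1 \<noteq> u2" "u0 \<noteq> u2" "u2 \<noteq> u3" "u3 \<noteq> u0" "u3 \<noteq> u1" using e a A1 A3 by auto
    have e2: "(u2, v2) \<in> ?H1" using e ne by auto
    have e3: "(u3, v3) \<in> ?H2" using e ne by auto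
    let ?D = "{(u0, v1), (u1, v2), (u2, v3), (u3, v0), (u1, v1), (u2, v2), (u3, v3)}"
    let ?G = "insert (u0, v1) (insert (u1, v2) (insert (u2, v3) (insert (u3, v0) ?H3)))"
    show False
    proof (rule stuck[of ?G ?D])
      fix x
      show "row_degree ?G x = row_degree H x + of_bool (x = u0)"
        using e a fH ne row_degree_remove[OF fH e(2), of x] row_degree_remove[OF _ e2, of x]
          row_degree_remove[OF _ e3, of x] by (simp add: row_degree_insert)
      show "col_degree ?G x = col_degree H x + of_bool (x = v0)"
        using e a fH ne col_degree_remove[OF fH e(2), of x] col_degree_remove[OF _ e2, of x]
          col_degree_remove[OF _ e3, of x] by (simp add: col_degree_insert)
    next
      show "card ?D \<le> 7" 
        by (rule order_trans[OF card_length[of "[(u0, v1), (u1, v2), (u2, v3), (u3, v0), (u1, v1), (u2, v2), (u3, v3)]", simplified]]) simp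
    qed (use e H u0 v0 Hmem in auto)
  qed
  \<comment> \<open>Leaving a row vertex through a non-edge and a column through an edge gives the
    layers. The complements \<open>X2\<close> and \<open>X3\<close> consist of the columns adjacent
    to all of \<open>U1\<close> and to all of \<open>U2\<close>.\<close>
  define V1 where "V1 = {v. v < m \<and> (u0, v) \<notin> H}"
  define U1 where "U1 = insert u0 {u. \<exists>v\<in>V1. (u, v) \<in> H}"
  define V2 where "V2 = {v. v < m \<and> (\<exists>u\<in>U1. (u, v) \<notin> H)}"
  define U2 where "U2 = U1 \<union> {u. \<exists>v\<in>V2. (u, v) \<in> H}"
  define V3 where "V3 = {v. v < m \<and> (\<exists>u\<in>U2. (u, v) \<notin> H)}"
  define X2 where "X2 = {0..<m} - V2"
  define X3 where "X3 = {0..<m} - V3"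
  have U_sub: "U1 \<subseteq> U2" "U2 \<subseteq> {0..<n}" using Hmem u0 by (auto simp: U1_def U2_def)
  have fU: "finite U2" "finite U1"
    using finite_subset[OF U_sub(2)] finite_subset[OF U_sub(1)] by simp_all
  have V_sub: "V2 \<subseteq> V3" "V3 \<subseteq> {0..<m}" using U_sub by (auto simp: V2_def V3_def)
  have fV: "finite V3" "finite V2"
    using finite_subset[OF V_sub(2)] finite_subset[OF V_sub(1)] by simp_all
  have U1_v0: "(u, v0) \<in> H" if "u \<in> U1" for u using that A1 A3 by (auto simp: U1_def V1_def)
  have U2_v0: "(u, v0) \<in> H" if "u \<in> U2" for u
    using that U1_v0 A3 A5 by (auto simp: U2_def V2_def U1_def V1_def)
  have V3_v0: "(a, v0) \<in> H" if "v \<in> V3" "(a, v) \<in> H" for a v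
  proof -
    obtain u where u: "u \<in> U2" "(u, v) \<notin> H" using \<open>v \<in> V3\<close> by (auto simp: V3_def)
    show ?thesis
    proof (cases "u \<in> U1")
      case True then show ?thesis using A3 A5 u that by (auto simp: U1_def V1_def)
    next
      case False
      then obtain v2 u1 where "(u, v2) \<in> H" "u1 \<in> U1" "(u1, v2) \<notin> H" "v2 < m" 
        using u by (auto simp: U2_def V2_def)
      then show ?thesis using A5 A7 u that by (auto simp: U1_def V1_def)
    qed
  qed
  \<comment> \<open>\<open>v0\<close> lacks one edge, so its degree in \<open>H\<close> is at most
    \<open>c2 - 1\<close>.\<close>
  have "U2 \<subseteq> {u. (u, v0) \<in> H}" using U2_v0 by auto
  then have "card U2 \<le> col_degree H v0"
    unfolding col_degree_def by (intro card_mono finite_col fH)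
  then have r2: "card U2 + 1 \<le> c2" using col[OF v0] dv[OF v0] by simp
  have r12: "card U1 \<le> card U2" using U_sub fU by (intro card_mono)
  have x32: "card X3 \<le> card X2" using V_sub by (intro card_mono) (auto simp: X2_def X3_def)
  have v0X: "v0 \<notin> V2" "v0 \<in> X3" using U2_v0 U_sub v0 by (auto simp: V2_def X3_def V3_def)
  \<comment> \<open>Since \<open>c2 < n\<close>, some row \<open>a\<close> is not adjacent to
    \<open>v0\<close>. Every neighbour of \<open>V3\<close> is adjacent to \<open>v0\<close>, so all
    neighbours of \<open>a\<close> lie in \<open>X3 - {v0}\<close>, and \<open>X3\<close> has at
    least \<open>d1 + 1\<close> elements.\<close>
  have "\<exists>a<n. (a, v0) \<notin> H"
  proof (rule ccontr)
    assume "\<not> ?thesis"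
    then have "{0..<n} \<subseteq> {u. (u, v0) \<in> H}" by auto
    then have "card {0..<n} \<le> col_degree H v0"
      unfolding col_degree_def by (intro card_mono finite_col fH)
    then show False using col[OF v0] dv[OF v0] c by simp
  qed
  then obtain a where a: "a < n" "(a, v0) \<notin> H" by blast
  have "{v. (a, v) \<in> H} \<subseteq> X3 - {v0}" using V3_v0 a Hmem by (auto simp: X3_def)
  then have "row_degree H a \<le> card (X3 - {v0})"
    unfolding row_degree_def by (intro card_mono) (auto simp: X3_def)
  moreover have "a \<noteq> u0" using a A1 by auto
  moreover have "0 < card X3" using v0X by (auto simp: card_gt_0_iff X3_def)
  ultimately have x3: "d1 + 1 \<le> card X3" using row[OF a(1)] du[OF a(1)] v0X by simp linarith
  \<comment> \<open>A column of \<open>V1\<close> differs from \<open>v0\<close> and has all its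
    neighbours in \<open>U1\<close>, so \<open>U1\<close> has at least \<open>c1\<close>
    elements.\<close>
  have "\<exists>v. v \<in> V1"
  proof (rule ccontr)
    assume "\<not> ?thesis"
    then have "{0..<m} \<subseteq> {v. (u0, v) \<in> H}" by (auto simp: V1_def)
    then have "card {0..<m} \<le> row_degree H u0"
      unfolding row_degree_def by (intro card_mono finite_row fH)
    then show False using row[OF u0] du[OF u0] d by simp
  qed
  then obtain v where v: "v \<in> V1" by blast
  have "{u. (u, v) \<in> H} \<subseteq> U1" using v by (auto simp: U1_def)
  then have "col_degree H v \<le> card U1" unfolding col_degree_def using fU by (intro card_mono)
  moreover have "v \<noteq> v0" "v < m" using v A1 by (auto simp: V1_def)
  ultimately have r1: "c1 \<le> card U1" using col[of v] dv[of v] by simp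
  have split_row: "row_degree H u = card ({0..<m} - V) + card {v \<in> V. (u, v) \<in> H}" 
    if "V \<subseteq> {0..<m}" "\<And>v. v < m \<Longrightarrow> v \<notin> V \<Longrightarrow> (u, v) \<in> H" for u V
  proof -
    have "{v. (u, v) \<in> H} = ({0..<m} - V) \<union> {v \<in> V. (u, v) \<in> H}" using that Hmem by auto
    then show ?thesis unfolding row_degree_def using finite_subset[OF that(1)]
      by (subst card_Un_disjoint[symmetric]) auto
  qed
  \<comment> \<open>The missing edge at \<open>u0\<close> is recorded because it survives as the
    \<open>- 1\<close> below. This makes the final inequality strict and so contradicts the
    non-strict hypothesis.\<close>
  have e1: "card X2 + card {v \<in> V2. (u, v) \<in> H} + of_bool (u = u0) \<le> d2" if "u \<in> U1" for u
  proof -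
    have "u < n" using that U_sub by auto
    then show ?thesis using split_row[of V2 u] row[of u] du[of u] that V_sub by (auto simp: X2_def V2_def)
  qed
  have e2: "card X3 + card {v \<in> V2. (u, v) \<in> H} \<le> d2" if "u \<in> U2" for u
  proof -
    have "u < n" using that U_sub by auto
    moreover have "card {v \<in> V2. (u, v) \<in> H} \<le> card {v \<in> V3. (u, v) \<in> H}"
      using V_sub fV by (intro card_mono) auto
    ultimately show ?thesis
      using split_row[of V3 u] row[of u] du[of u] that V_sub by (auto simp: X3_def V3_def)
  qed
  have "c1 * card V2 = (\<Sum>v\<in>V2. c1)" by simp
  also have "\<dots> \<le> (\<Sum>v\<in>V2. card {u \<in> U2. (u, v) \<in> H})"
  proof (rule sum_mono)
    fix v assume v: "v \<in> V2"
    have "{u \<in> U2. (u, v) \<in> H} = {u. (u, v) \<in> H}" using v by (auto simp: U2_def)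
    then have "card {u \<in> U2. (u, v) \<in> H} = col_degree H v" by (simp add: col_degree_def)
    moreover have "v < m" "v \<noteq> v0" using v v0X V_sub by auto
    ultimately show "c1 \<le> card {u \<in> U2. (u, v) \<in> H}" using col[of v] dv[of v] by simp
  qed
  also have "\<dots> = (\<Sum>u\<in>U2. card {v \<in> V2. (u, v) \<in> H})"
    using card_edges_by_row[OF fU(1) fV(2)] card_edges_by_col[OF fU(1) fV(2)] by simp
  also have "\<dots> = (\<Sum>u\<in>U1. card {v \<in> V2. (u, v) \<in> H}) + (\<Sum>u\<in>U2-U1. card {v \<in> V2. (u, v) \<in> H})"
    using sum.subset_diff[OF U_sub(1) fU(1)] by (simp add: add.commute)
  finally have "int (c1 * card V2) \<le> (\<Sum>u\<in>U1. int (card {v \<in> V2. (u, v) \<in> H})) + (\<Sum>u\<in>U2-U1. int (card {v \<in> V2. (u, v) \<in> H}))"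
    by (simp flip: of_nat_sum of_nat_add del: of_nat_mult)
  also have "\<dots> \<le> (\<Sum>u\<in>U1. int d2 - int (card X2) - of_bool (u = u0)) + (\<Sum>u\<in>U2-U1. int d2 - int (card X3))"
  proof (intro add_mono sum_mono)
    fix u assume "u \<in> U1" then show "int (card {v \<in> V2. (u, v) \<in> H}) \<le> int d2 - int (card X2) - of_bool (u = u0)"
      using e1[of u] by (auto split: if_splits)
  next
    fix u assume "u \<in> U2 - U1" then show "int (card {v \<in> V2. (u, v) \<in> H}) \<le> int d2 - int (card X3)"
      using e2[of u] by auto
  qed
  also have "\<dots> = int (card U1) * (int d2 - int (card X2)) - 1 + (int (card U2) - int (card U1)) * (int d2 - int (card X3))"
    using fU U_sub r12 by (simp add: sum_subtractf card_Diff_subset of_nat_diff U1_def[symmetric]) 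
       (auto simp: U1_def of_bool_def)
  finally have count: "int c1 * int (card V2) \<le> int (card U1) * (int d2 - int (card X2)) - 1 + (int (card U2) - int (card U1)) * (int d2 - int (card X3))"
    by simp
  have "card X2 = m - card V2" unfolding X2_def using V_sub fV by (subst card_Diff_subset) auto
  moreover have "card V2 \<le> m" using card_mono[of "{0..<m}" V2] V_sub by auto
  ultimately have V2: "int (card V2) = int m - int (card X2)" by simp
  have "u0 \<in> U1" by (simp add: U1_def)
  then have x2: "card X2 \<le> d2" using e1[of u0] by simp
  \<comment> \<open>Splitting off \<open>c1\<close> copies of \<open>d2 - card X2\<close> isolates
    the right-hand side of the hypothesis. The rest is a product of two nonnegative factors, bounded
    by \<open>card U2 \<le> c2 - 1\<close> and \<open>card X3 \<ge> d1 + 1\<close>.\<close>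
  have "int c1 * (int m - int d2) = int c1 * int (card V2) - int c1 * (int d2 - int (card X2))"
    by (simp add: V2 algebra_simps)
  also have "\<dots> \<le> (int (card U1) - int c1) * (int d2 - int (card X2)) + (int (card U2) - int (card U1)) * (int d2 - int (card X3)) - 1"
    using count by (simp add: algebra_simps)
  also have "\<dots> \<le> (int (card U1) - int c1) * (int d2 - int (card X3)) + (int (card U2) - int (card U1)) * (int d2 - int (card X3)) - 1"
    using r1 x32 by (intro diff_mono add_mono mult_left_mono order_refl) auto
  also have "\<dots> = (int (card U2) - int c1) * (int d2 - int (card X3)) - 1" by (simp add: algebra_simps)
  also have "\<dots> \<le> (int c2 - int c1 - 1) * (int d2 - int d1 - 1) - 1"
    using r1 r12 r2 x3 x2 x32 by (intro diff_right_mono mult_mono) auto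
  finally show False using cond by simp
qed

end

locale stable_degrees = degree_bounds +
  assumes cond: "(int c2 - int c1 - 1) * (int d2 - int d1 - 1)
        \<le> max (int c1 * (int m - int d2)) (int d1 * (int n - int c2))"
begin

text \<open>Taking the converse relation exchanges the row and column bounds and turns the second
  alternative of the maximum into the first.\<close>

lemma repair_deficit:
  assumes H: "H \<subseteq> {0..<n} \<times> {0..<m}" and u0: "u0 < n" and v0: "v0 < m"
    and row: "\<And>i. i < n \<Longrightarrow> row_degree H i + of_bool (i = u0) = du i"
    and col: "\<And>j. j < m \<Longrightarrow> col_degree H j + of_bool (j = v0) = dv j"
  shows "\<exists>G\<in>realizations n m du dv. hamming H G \<le> 7"
proof (cases "(int c2 - int c1 - 1) * (int d2 - int d1 - 1) \<le> int c1 * (int m - int d2)")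
  case True
  then show ?thesis using repair_deficit_aux assms by blast
next
  case False
  interpret c: degree_bounds m n d1 d2 c1 c2 dv du by (rule degree_bounds_converse)
  have "H\<inverse> \<subseteq> {0..<m} \<times> {0..<n}" using H by auto
  moreover have "(int d2 - int d1 - 1) * (int c2 - int c1 - 1) \<le> int d1 * (int n - int c2)"
    using cond False by (simp add: mult.commute)
  ultimately have "\<exists>G\<in>realizations m n dv du. hamming (H\<inverse>) G \<le> 7"
    using u0 v0 row col by (intro c.repair_deficit_aux[of _ v0 u0]) auto
  then obtain G where "G \<in> realizations m n dv du" "hamming (H\<inverse>) G \<le> 7" by blast
  then show ?thesis
    using realizations_converse hamming_converse[of "H\<inverse>" G] by (intro bexI[of _ "G\<inverse>"]) auto
qed

lemma remove_edge:
  assumes H: "H \<subseteq> {0..<n} \<times> {0..<m}" and e: "e \<in> H" 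
    and G: "G \<in> realizations n m du dv" "hamming (H - {e}) G \<le> k"
  shows "hamming H G \<le> k + 1"
proof -
  have "finite H" "finite G" using H G by (auto simp: mem_realizations intro: finite_subset)
  then have "hamming H G \<le> hamming H (H - {e}) + hamming (H - {e}) G" by (intro hamming_triangle) auto
  also have "hamming H (H - {e}) \<le> 1" by (rule hamming_le_cover[of "{e}"]) auto
  finally show ?thesis using G by simp
qed

text \<open>Deleting any edge \<open>(a', b)\<close> at the overfull row leaves exactly the deficit
  pair \<open>a\<close>, \<open>b\<close>, at the cost of one more cell.\<close>

lemma repair_rows:
  assumes H: "H \<subseteq> {0..<n} \<times> {0..<m}" and a: "a < n" "a' < n"
    and row: "\<And>i. i < n \<Longrightarrow> row_degree H i + of_bool (i = a) = du i + of_bool (i = a')"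
    and col: "\<And>j. j < m \<Longrightarrow> col_degree H j = dv j"
  shows "\<exists>G\<in>realizations n m du dv. hamming H G \<le> 8"
proof (cases "a = a'")
  case True
  then have "H \<in> realizations n m du dv" using assms by (simp add: mem_realizations)
  then show ?thesis by force
next
  case False
  have fH: "finite H" by (rule finite_subset[OF H]) simp
  have "row_degree H a' > 0" using row[OF a(2)] False by simp
  then obtain b where b: "(a', b) \<in> H" by (auto simp: row_degree_def card_gt_0_iff)
  have "\<exists>G\<in>realizations n m du dv. hamming (H - {(a', b)}) G \<le> 7"
  proof (rule repair_deficit)
    fix i assume "i < n" then show "row_degree (H - {(a', b)}) i + of_bool (i = a) = du i"
      using row_degree_remove[OF fH b, of i] row[of i] by simp
  next
    fix j assume "j < m" then show "col_degree (H - {(a', b)}) j + of_bool (j = b) = dv j"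
      using col_degree_remove[OF fH b, of j] col[of j] by simp
  qed (use H a b in auto)
  then show ?thesis using remove_edge[OF H b] by force
qed

lemma repair_cols:
  assumes H: "H \<subseteq> {0..<n} \<times> {0..<m}" and b: "b < m" "b' < m"
    and row: "\<And>i. i < n \<Longrightarrow> row_degree H i = du i"
    and col: "\<And>j. j < m \<Longrightarrow> col_degree H j + of_bool (j = b) = dv j + of_bool (j = b')"
  shows "\<exists>G\<in>realizations n m du dv. hamming H G \<le> 8"
proof -
  have "degree_bounds m n d1 d2 c1 c2 dv du" by (rule degree_bounds_converse)
  then interpret c: stable_degrees m n d1 d2 c1 c2 dv du
    using cond by (simp add: stable_degrees_def stable_degrees_axioms_def max.commute mult.commute)
  have "\<exists>G\<in>realizations m n dv du. hamming (H\<inverse>) G \<le> 8"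
    using assms by (intro c.repair_rows[of _ b b']) auto
  then obtain G where "G \<in> realizations m n dv du" "hamming (H\<inverse>) G \<le> 8" by blast
  then show ?thesis
    using realizations_converse hamming_converse[of "H\<inverse>" G] by (intro bexI[of _ "G\<inverse>"]) auto
qed

text \<open>Deleting an edge at the overfull row \<open>a\<close> moves the defect to two columns,
  one short and one overfull, or cancels it.\<close>

lemma repair_surplus:
  assumes H: "H \<subseteq> {0..<n} \<times> {0..<m}" and a: "a < n" and b: "b < m"
    and row: "\<And>i. i < n \<Longrightarrow> row_degree H i = du i + of_bool (i = a)"
    and col: "\<And>j. j < m \<Longrightarrow> col_degree H j = dv j + of_bool (j = b)"
  shows "\<exists>G\<in>realizations n m du dv. hamming H G \<le> 9"
proof -
  have fH: "finite H" by (rule finite_subset[OF H]) simp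
  have "row_degree H a > 0" using row[OF a] by simp
  then obtain b' where b': "(a, b') \<in> H" by (auto simp: row_degree_def card_gt_0_iff)
  have "\<exists>G\<in>realizations n m du dv. hamming (H - {(a, b')}) G \<le> 8"
  proof (rule repair_cols)
    fix i assume "i < n" then show "row_degree (H - {(a, b')}) i = du i"
      using row_degree_remove[OF fH b', of i] row[of i] by simp
  next
    fix j assume "j < m" then show "col_degree (H - {(a, b')}) j + of_bool (j = b') = dv j + of_bool (j = b)"
      using col_degree_remove[OF fH b', of j] col[of j] by simp
  qed (use H b b' in auto)
  then show ?thesis using remove_edge[OF H b'] by force
qed

end

section \<open>Connecting nearby realizations by swaps\<close>

lemma is_swapE:
  assumes "is_swap G G'"
  obtains u1 u2 v1 v2 where "u1 \<noteq> u2" "v1 \<noteq> v2" "(u1, v1) \<in> G" "(u2, v2) \<in> G" "(u1, v2) \<notin> G" "(u2, v1) \<notin> G"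
    "G' = (G - {(u1, v1), (u2, v2)}) \<union> {(u1, v2), (u2, v1)}"
  using assms unfolding is_swap_def by blast

lemma is_swap_sym: "is_swap G G' \<Longrightarrow> is_swap G' G"
proof (elim is_swapE)
  fix u1 u2 v1 v2
  assume a: "u1 \<noteq> u2" "v1 \<noteq> v2" "(u1, v1) \<in> G" "(u2, v2) \<in> G" "(u1, v2) \<notin> G" "(u2, v1) \<notin> G"
    "G' = (G - {(u1, v1), (u2, v2)}) \<union> {(u1, v2), (u2, v1)}"
  then have *: "v2 \<noteq> v1" "(u1, v2) \<in> G'" "(u2, v1) \<in> G'" "(u1, v1) \<notin> G'" "(u2, v2) \<notin> G'" by auto
  from a have G: "G = (G' - {(u1, v2), (u2, v1)}) \<union> {(u1, v1), (u2, v2)}" by blast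
  show "is_swap G' G" unfolding is_swap_def
    by (intro exI[of _ u1] exI[of _ u2] exI[of _ v2] exI[of _ v1] conjI) (fact a(1) * G)+
qed

lemma is_swap_irrefl: "\<not> is_swap G G"
  by (auto elim!: is_swapE)

lemma finite_realization: "G \<in> realizations n m du dv \<Longrightarrow> finite G"
  by (auto simp: mem_realizations intro: finite_subset)

lemma finite_realizations: "finite (realizations n m du dv)"
proof (rule finite_subset)
  show "realizations n m du dv \<subseteq> Pow ({0..<n} \<times> {0..<m})" unfolding realizations_def by blast
qed simp

lemma swap_realization:
  assumes G: "G \<in> realizations n m du dv" and sw: "is_swap G G'"
  shows "G' \<in> realizations n m du dv" "hamming G G' \<le> 4"
proof -
  from sw obtain u1 u2 v1 v2 where e: "u1 \<noteq> u2" "v1 \<noteq> v2" "(u1, v1) \<in> G" "(u2, v2) \<in> G" "(u1, v2) \<notin> G" "(u2, v1) \<notin> G"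
    and G': "G' = (G - {(u1, v1), (u2, v2)}) \<union> {(u1, v2), (u2, v1)}" by (rule is_swapE)
  have fG: "finite G" using G by (rule finite_realization)
  let ?G1 = "G - {(u1, v1)}"
  have e2: "(u2, v2) \<in> ?G1" using e by auto
  have eq: "G' = insert (u1, v2) (insert (u2, v1) (?G1 - {(u2, v2)}))" using G' by auto
  have "row_degree G' x = row_degree G x" "col_degree G' x = col_degree G x" for x
    using e fG row_degree_remove[OF fG e(3), of x] row_degree_remove[OF _ e2, of x]
      col_degree_remove[OF fG e(3), of x] col_degree_remove[OF _ e2, of x]
    by (simp_all add: eq row_degree_insert col_degree_insert)
  moreover have "G' \<subseteq> {0..<n} \<times> {0..<m}" using G e by (auto simp: G' mem_realizations)
  ultimately show "G' \<in> realizations n m du dv" using G by (simp add: mem_realizations)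
  show "hamming G G' \<le> 4"
    by (rule hamming_le_cover[of "{(u1, v1), (u2, v2), (u1, v2), (u2, v1)}"])
       (use e G' in \<open>auto simp: card_insert_if\<close>)
qed

lemma card_Diff_commute:
  "finite A \<Longrightarrow> finite B \<Longrightarrow> card A = card B \<Longrightarrow> card (A - B) = card (B - A)"
  by (simp add: card_Diff_subset_Int Int_commute)

lemma degree_Diff_commute:
  assumes "finite G" "finite H"
  shows "row_degree G i = row_degree H i \<Longrightarrow> row_degree (G - H) i = row_degree (H - G) i"
    and "col_degree G i = col_degree H i \<Longrightarrow> col_degree (G - H) i = col_degree (H - G) i"
  using card_Diff_commute[OF finite_row[OF assms(1)] finite_row[OF assms(2)], of i i]
    card_Diff_commute[OF finite_col[OF assms(1)] finite_col[OF assms(2)], of i i]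
  by (simp_all add: row_degree_def col_degree_def set_diff_eq)

lemma hamming_less:
  assumes fin: "finite G" "finite H"
    and e: "{e1, e2, e3} \<subseteq> (G - H) \<union> (H - G)" "distinct [e1, e2, e3]"
    and K: "(K - H) \<union> (H - K) \<subseteq> insert e4 ((G - H) \<union> (H - G) - {e1, e2, e3})"
  shows "hamming K H < hamming G H"
proof -
  let ?S = "(G - H) \<union> (H - G)"
  have fS: "finite ?S" using fin by simp
  have three: "card {e1, e2, e3} = 3" using e(2) by simp
  have "hamming K H \<le> card (insert e4 (?S - {e1, e2, e3}))"
    unfolding hamming_def using fS by (intro card_mono K) simp
  also have "\<dots> \<le> Suc (card (?S - {e1, e2, e3}))" using fS by (simp add: card_insert_if)
  also have "card (?S - {e1, e2, e3}) = card ?S - 3"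
    using e(1) by (subst card_Diff_subset) (simp_all only: three finite.intros)
  also have "Suc (card ?S - 3) < card ?S" using card_mono[OF fS e(1)] three by simp
  finally show ?thesis by (simp add: hamming_def)
qed

text \<open>A row \<open>u1\<close> with the fewest edges of \<open>G - G'\<close> guarantees that the swap, performed on \<open>G\<close> or on \<open>G'\<close>,
  creates at most one new discrepancy.\<close>

lemma swap_towards:
  assumes G: "G \<in> realizations n m du dv" "G' \<in> realizations n m du dv" and ne: "G \<noteq> G'"
  shows "(\<exists>K. is_swap G K \<and> hamming K G' < hamming G G') \<or> (\<exists>K. is_swap G' K \<and> hamming G K < hamming G G')"
proof -
  have fin: "finite G" "finite G'" using G finite_realization by auto
  have rows: "row_degree (G - G') i = row_degree (G' - G) i" for i
  proof (cases "i < n")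
    case True
    then show ?thesis using degree_Diff_commute(1)[OF fin, of i] G by (simp add: mem_realizations)
  next
    case False
    then have "{j. (i, j) \<in> G} = {}" "{j. (i, j) \<in> G'} = {}" using G by (auto simp: mem_realizations)
    then show ?thesis by (auto simp: row_degree_def intro: arg_cong[of _ _ card])
  qed
  have cols: "col_degree (G - G') j = col_degree (G' - G) j" if "j < m" for j
    using that degree_Diff_commute(2)[OF fin, of j] G by (simp add: mem_realizations)
  have row_pos: "row_degree F i > 0 \<longleftrightarrow> (\<exists>j. (i, j) \<in> F)" if "finite F" for F i
    using finite_row[OF that] by (auto simp: row_degree_def card_gt_0_iff)
  have col_pos: "col_degree F j > 0 \<longleftrightarrow> (\<exists>i. (i, j) \<in> F)" if "finite F" for F j
    using finite_col[OF that] by (auto simp: col_degree_def card_gt_0_iff)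
  have fD: "finite (G - G')" "finite (G' - G)" using fin by auto
  have "\<exists>i. row_degree (G - G') i > 0"
  proof (rule ccontr)
    assume none: "\<not> ?thesis"
    have "(i, j) \<notin> G - G'" for i j using none row_pos[OF fD(1), of i] by blast
    moreover have "(i, j) \<notin> G' - G" for i j using none row_pos[OF fD(2), of i] rows[of i] by metis
    ultimately show False using ne by auto
  qed
  then obtain u1 where u1: "row_degree (G - G') u1 > 0"
    and least: "\<And>i. row_degree (G - G') i > 0 \<Longrightarrow> row_degree (G - G') u1 \<le> row_degree (G - G') i"
    using ex_has_least_nat[of "\<lambda>i. row_degree (G - G') i > 0" _ "row_degree (G - G')"] by blast
  obtain v1 where v1: "(u1, v1) \<in> G - G'" using u1 row_pos[OF fD(1)] by blast
  then have "v1 < m" using G by (auto simp: mem_realizations)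
  then obtain u2 where u2: "(u2, v1) \<in> G' - G" using cols col_pos[OF fD(1), of v1] col_pos[OF fD(2), of v1] v1 by auto
  then have "row_degree (G - G') u2 > 0" using rows row_pos[OF fD(2)] by auto
  then have le: "row_degree (G - G') u1 \<le> row_degree (G - G') u2" by (rule least)
  \<comment> \<open>Otherwise row \<open>u2\<close> of \<open>G - G'\<close> would be contained in
    row \<open>u1\<close> without \<open>v1\<close>, against the minimality of
    \<open>u1\<close>.\<close>
  have "\<exists>v2. (u2, v2) \<in> G - G' \<and> (u1, v2) \<notin> G - G'"
  proof (rule ccontr)
    assume "\<not> ?thesis"
    then have "{j. (u2, j) \<in> G - G'} \<subseteq> {j. (u1, j) \<in> G - G'} - {v1}" using u2 by auto
    then have "row_degree (G - G') u2 \<le> card ({j. (u1, j) \<in> G - G'} - {v1})"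
      unfolding row_degree_def using finite_row[OF fD(1)] by (intro card_mono) auto
    also have "\<dots> < row_degree (G - G') u1"
      unfolding row_degree_def using finite_row[OF fD(1)] v1 by (intro psubset_card_mono) auto
    finally show False using le by simp
  qed
  then obtain v2 where v2: "(u2, v2) \<in> G - G'" "(u1, v2) \<notin> G - G'" by blast
  have ne: "u1 \<noteq> u2" "v1 \<noteq> v2" using v1 v2 u2 by auto
  show ?thesis
  \<comment> \<open>Three corners of the square are discrepancies of known type. The fourth is
    absent from \<open>G\<close>, so that \<open>G\<close> can be swapped, or lies in both graphs,
    so that \<open>G'\<close> can.\<close>
  proof (cases "(u1, v2) \<in> G")
    case False
    let ?K = "(G - {(u1, v1), (u2, v2)}) \<union> {(u1, v2), (u2, v1)}"
    have "is_swap G ?K" unfolding is_swap_def using False v1 v2 u2 ne by blast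
    moreover have "hamming ?K G' < hamming G G'"
      by (rule hamming_less[of _ _ "(u1, v1)" "(u2, v2)" "(u2, v1)" _ "(u1, v2)"])
         (use False v1 v2 u2 ne fin in auto)
    ultimately show ?thesis by blast
  next
    case True
    then have True': "(u1, v2) \<in> G'" using v2 by auto
    let ?K = "(G' - {(u1, v2), (u2, v1)}) \<union> {(u1, v1), (u2, v2)}"
    have "is_swap G' ?K" unfolding is_swap_def using True' v1 v2 u2 ne 
      by (intro exI[of _ u1] exI[of _ u2] exI[of _ v2] exI[of _ v1]) auto
    moreover have "hamming ?K G < hamming G' G"
      by (rule hamming_less[of _ _ "(u1, v1)" "(u2, v2)" "(u2, v1)" _ "(u1, v2)"])
         (use True True' v1 v2 u2 ne fin in auto)
    ultimately show ?thesis by (metis hamming_commute)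
  qed
qed

text \<open>\<open>swap_towards\<close> may move either endpoint, so both carry a budget: each swap
  moves one of them by at most 4 and lowers \<open>h\<close>. This keeps the whole path in a ball
  around \<open>Z\<close>, which is what makes the resulting energy bound local.\<close>

lemma swap_path_bound:
  fixes f :: "(nat \<times> nat) set \<Rightarrow> real"
  assumes Z: "finite Z" and M: "0 \<le> M"
    and step: "\<And>G1 G2. G1 \<in> realizations n m du dv \<Longrightarrow> G2 \<in> realizations n m du dv \<Longrightarrow> is_swap G1 G2 \<Longrightarrow>
        hamming Z G1 \<le> r \<Longrightarrow> \<bar>f G1 - f G2\<bar> \<le> M"
  shows "G \<in> realizations n m du dv \<Longrightarrow> G' \<in> realizations n m du dv \<Longrightarrow> hamming G G' \<le> h \<Longrightarrow>
    hamming Z G + 4 * h \<le> r \<Longrightarrow> hamming Z G' + 4 * h \<le> r \<Longrightarrow> \<bar>f G - f G'\<bar> \<le> real h * M"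
proof (induction h arbitrary: G G')
  case 0
  have "finite G" "finite G'" using 0 finite_realization by auto
  then have "(G - G') \<union> (G' - G) = {}" using 0 by (auto simp: hamming_def)
  then have "G = G'" by blast
  then show ?case by simp
next
  case (Suc h)
  show ?case
  proof (cases "G = G'")
    case True then show ?thesis using M by simp
  next
    case False
    have far: "hamming Z K \<le> hamming Z F + 4" if "F \<in> realizations n m du dv" "is_swap F K" for F K
      using hamming_triangle[OF Z, of F K] swap_realization[OF that] finite_realization that(1) by force
    from swap_towards[OF Suc.prems(1,2) False] show ?thesis
    proof (elim disjE exE conjE)
      fix K assume K: "is_swap G K" "hamming K G' < hamming G G'"
      have KR: "K \<in> realizations n m du dv" using swap_realization Suc.prems K by blast
      have "\<bar>f K - f G'\<bar> \<le> real h * M"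
        using Suc.prems K KR far[OF Suc.prems(1) K(1)] by (intro Suc.IH) auto
      moreover have "\<bar>f G - f K\<bar> \<le> M" using step[OF Suc.prems(1) KR K(1)] Suc.prems by simp
      ultimately show ?thesis by (simp add: distrib_right)
    next
      fix K assume K: "is_swap G' K" "hamming G K < hamming G G'"
      have KR: "K \<in> realizations n m du dv" using swap_realization Suc.prems K by blast
      have "\<bar>f G - f K\<bar> \<le> real h * M"
        using Suc.prems K KR far[OF Suc.prems(2) K(1)] by (intro Suc.IH) auto
      moreover have "\<bar>f G' - f K\<bar> \<le> M" using step[OF Suc.prems(2) KR K(1)] Suc.prems by simp
      ultimately show ?thesis by (simp add: distrib_right)
    qed
  qed
qed

definition swap_energy :: "(nat \<times> nat) set set \<Rightarrow> (nat \<times> nat) set set \<Rightarrow> ((nat \<times> nat) set \<Rightarrow> real) \<Rightarrow> real" where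
  "swap_energy R B f = (\<Sum>G1\<in>B. \<Sum>G2\<in>R. if is_swap G1 G2 then (f G1 - f G2)\<^sup>2 else 0)"

text \<open>Every squared swap difference in the ball is a single term of the local energy, so its
  root serves as \<open>M\<close>. The radius \<open>5 * h\<close> is the distance \<open>h\<close>
  of \<open>G'\<close> plus the budget \<open>4 * h\<close>.\<close>

lemma swap_local_energy:
  fixes f :: "(nat \<times> nat) set \<Rightarrow> real"
  assumes R_def: "R = realizations n m du dv" and G: "G \<in> R" "G' \<in> R" "hamming G G' \<le> h"
  shows "(f G - f G')\<^sup>2 \<le> (real h)\<^sup>2 * swap_energy R {G1 \<in> R. hamming G G1 \<le> 5 * h} f"
proof -
  let ?B = "{G1 \<in> R. hamming G G1 \<le> 5 * h}"
  let ?E = "swap_energy R ?B f"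
  have fR: "finite R" by (simp add: R_def finite_realizations)
  have E0: "0 \<le> ?E" by (auto simp: swap_energy_def intro!: sum_nonneg)
  have "\<bar>f G1 - f G2\<bar> \<le> sqrt ?E" if "G1 \<in> R" "G2 \<in> R" "is_swap G1 G2" "hamming G G1 \<le> 5 * h" for G1 G2
  proof -
    have "(f G1 - f G2)\<^sup>2 = (if is_swap G1 G2 then (f G1 - f G2)\<^sup>2 else 0)" using that by simp
    also have "\<dots> \<le> (\<Sum>G2\<in>R. if is_swap G1 G2 then (f G1 - f G2)\<^sup>2 else 0)"
      using that fR by (intro member_le_sum) auto
    also have "\<dots> \<le> ?E" unfolding swap_energy_def
      by (rule member_le_sum[of G1]) (use that fR in \<open>simp_all add: sum_nonneg\<close>)
    finally show ?thesis by (intro real_le_rsqrt) simp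
  qed
  then have "\<bar>f G - f G'\<bar> \<le> real h * sqrt ?E"
    using G finite_realization E0 unfolding R_def
    by (intro swap_path_bound[where Z = G and r = "5 * h"]) auto
  then have "\<bar>f G - f G'\<bar>\<^sup>2 \<le> (real h * sqrt ?E)\<^sup>2" by (intro power_mono) auto
  then show ?thesis using E0 by (simp add: power_mult_distrib)
qed

section \<open>Realizations as perfect matchings\<close>

lemma card_subsets_le:
  assumes "finite S"
  shows "finite {D. D \<subseteq> S \<and> card D \<le> k} \<and> card {D. D \<subseteq> S \<and> card D \<le> k} \<le> (card S + 1) ^ k"
proof (induction k)
  case 0
  have "{D. D \<subseteq> S \<and> card D \<le> 0} = {{}}"
    using assms by (auto dest: finite_subset[rotated] simp: card_0_eq[OF finite_subset[OF _ assms]])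
  then show ?case by simp
next
  case (Suc k)
  let ?F = "\<lambda>k. {D. D \<subseteq> S \<and> card D \<le> k}"
  let ?g = "\<lambda>(x, D). case x of None \<Rightarrow> D | Some x \<Rightarrow> insert x D"
  let ?O = "insert None (Some ` S)"
  have "?F (Suc k) \<subseteq> ?g ` (?O \<times> ?F k)"
  proof
    fix D assume D: "D \<in> ?F (Suc k)"
    show "D \<in> ?g ` (?O \<times> ?F k)"
    proof (cases "D = {}")
      case True then show ?thesis by (intro image_eqI[of _ _ "(None, {})"]) auto
    next
      case False
      then obtain x where x: "x \<in> D" by blast
      have "finite D" using D finite_subset[OF _ assms] by auto
      then have "D - {x} \<in> ?F k" using D x by auto
      then show ?thesis using D x by (intro image_eqI[of _ _ "(Some x, D - {x})"]) auto
    qed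
  qed
  moreover have fin: "finite (?O \<times> ?F k)" using Suc assms by auto
  ultimately have "card (?F (Suc k)) \<le> card (?g ` (?O \<times> ?F k))" by (intro card_mono finite_imageI)
  also have "\<dots> \<le> card (?O \<times> ?F k)" by (intro card_image_le fin)
  also have "\<dots> = (card S + 1) * card (?F k)"
    using assms by (simp add: card_cartesian_product card_image card_insert_if)
  also have "\<dots> \<le> (card S + 1) * (card S + 1) ^ k" using Suc by (intro mult_left_mono) auto
  finally show ?case using assms finite_subset[OF _ finite_Pow_iff[THEN iffD2, OF assms]] by auto
qed

lemma card_hamming_ball_le:
  assumes "finite S" "H \<subseteq> S"
  shows "card {T. T \<subseteq> S \<and> hamming T H \<le> k} \<le> (card S + 1) ^ k"
proof -
  define d where "d T = (T - H) \<union> (H - T)" for T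
  have "d (d T) = T" for T by (auto simp: d_def)
  then have "inj_on d {T. T \<subseteq> S \<and> hamming T H \<le> k}" by (metis inj_on_inverseI)
  then have "card {T. T \<subseteq> S \<and> hamming T H \<le> k} = card (d ` {T. T \<subseteq> S \<and> hamming T H \<le> k})"
    by (rule card_image[symmetric])
  also have "\<dots> \<le> card {D. D \<subseteq> S \<and> card D \<le> k}"
    using card_subsets_le[OF assms(1), of k] assms(2) by (intro card_mono) (auto simp: hamming_def d_def)
  finally show ?thesis using card_subsets_le[OF assms(1), of k] by linarith
qed

text \<open>Extensional functions keep these sets finite. For \<open>X = Y\<close> finite the
  cardinality is the product of the factorials of the label class sizes; only comparisons between
  such numbers are needed, never their values.\<close>

definition lab_inj :: "('a \<Rightarrow> 'l) \<Rightarrow> 'a set \<Rightarrow> 'a set \<Rightarrow> ('a \<Rightarrow> 'a) set" where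
  "lab_inj lab X Y = {f \<in> X \<rightarrow>\<^sub>E Y. inj_on f X \<and> (\<forall>x\<in>X. lab (f x) = lab x)}"

lemma finite_lab_inj: "finite X \<Longrightarrow> finite Y \<Longrightarrow> finite (lab_inj lab X Y)"
  unfolding lab_inj_def using finite_PiE[of X "\<lambda>_. Y"] by simp

lemma lab_inj_exists:
  assumes fin: "finite X" "finite Y"
    and le: "\<And>l. card {x \<in> X. lab x = l} \<le> card {y \<in> Y. lab y = l}"
  shows "\<exists>h. h \<in> lab_inj lab X Y"
proof -
  have "\<exists>h. h ` {x \<in> X. lab x = l} \<subseteq> {y \<in> Y. lab y = l} \<and> inj_on h {x \<in> X. lab x = l}" for l
    using card_le_inj[of "{x \<in> X. lab x = l}" "{y \<in> Y. lab y = l}"] fin le[of l] by auto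
  then have "\<exists>h. \<forall>l. h l ` {x \<in> X. lab x = l} \<subseteq> {y \<in> Y. lab y = l} \<and> inj_on (h l) {x \<in> X. lab x = l}"
    by (intro choice allI)
  then obtain h where h: "\<And>l. h l ` {x \<in> X. lab x = l} \<subseteq> {y \<in> Y. lab y = l}"
    "\<And>l. inj_on (h l) {x \<in> X. lab x = l}" by blast
  define g where "g = restrict (\<lambda>x. h (lab x) x) X"
  have lab: "g x \<in> Y" "lab (g x) = lab x" if "x \<in> X" for x
    using h(1)[of "lab x"] that by (auto simp: g_def)
  have "inj_on g X"
  proof (rule inj_onI)
    fix x y assume xy: "x \<in> X" "y \<in> X" "g x = g y"
    then have "lab x = lab y" using lab by metis
    then show "x = y" using h(2)[of "lab x"] xy by (auto simp: g_def inj_on_def)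
  qed
  then have "g \<in> lab_inj lab X Y" using lab by (auto simp: lab_inj_def g_def)
  then show ?thesis by blast
qed

text \<open>Restriction along a label-preserving injection \<open>X \<rightarrow> X'\<close> maps \<open>lab_inj lab X' Y\<close> onto \<open>lab_inj lab X Y\<close>.\<close>

lemma card_lab_inj_le:
  assumes fin: "finite X" "finite X'" "finite Y"
    and eq: "\<And>l. card {x \<in> X'. lab x = l} = card {y \<in> Y. lab y = l}"
  shows "card (lab_inj lab X Y) \<le> card (lab_inj lab X' Y)"
proof (cases "lab_inj lab X Y = {}")
  case True then show ?thesis by simp
next
  case False
  then obtain f0 where f0: "f0 \<in> lab_inj lab X Y" by blast
  have class_le: "card {x \<in> X. lab x = l} \<le> card {y \<in> Y. lab y = l}" for l
    using f0 fin by (intro card_inj_on_le[of f0]) (auto simp: lab_inj_def inj_on_def)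
  then obtain g where g: "g \<in> lab_inj lab X X'" using lab_inj_exists[OF fin(1,2), of lab] eq by auto
  have gX: "inj_on g X" "g ` X \<subseteq> X'" "\<And>x. x \<in> X \<Longrightarrow> lab (g x) = lab x" using g by (auto simp: lab_inj_def)
  have "lab_inj lab X Y \<subseteq> (\<lambda>b. restrict (b \<circ> g) X) ` lab_inj lab X' Y"
  proof
    fix f assume f: "f \<in> lab_inj lab X Y"
    have fX: "inj_on f X" "f ` X \<subseteq> Y" "\<And>x. x \<in> X \<Longrightarrow> lab (f x) = lab x" "\<And>x. x \<notin> X \<Longrightarrow> f x = undefined"
      using f by (auto simp: lab_inj_def PiE_def extensional_def)
    have rest: "card {x \<in> Z - h ` X. lab x = l} = card {x \<in> Z. lab x = l} - card {x \<in> X. lab x = l}"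
      if "finite Z" "inj_on h X" "h ` X \<subseteq> Z" "\<And>x. x \<in> X \<Longrightarrow> lab (h x) = lab x" for Z h l
    proof -
      have "{x \<in> Z - h ` X. lab x = l} = {x \<in> Z. lab x = l} - h ` {x \<in> X. lab x = l}" using that by auto
      moreover have "card (h ` {x \<in> X. lab x = l}) = card {x \<in> X. lab x = l}"
        using that(2) by (intro card_image) (auto simp: inj_on_def)
      moreover have "h ` {x \<in> X. lab x = l} \<subseteq> {x \<in> Z. lab x = l}" using that by auto
      ultimately show ?thesis
        using card_Diff_subset[of "h ` {x \<in> X. lab x = l}" "{x \<in> Z. lab x = l}"] fin by simp
    qed
    have "\<exists>k. k \<in> lab_inj lab (X' - g ` X) (Y - f ` X)"
      using fin rest[OF fin(2) gX] rest[OF fin(3) fX(1-3)] eq by (intro lab_inj_exists) auto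
    then obtain k where k: "inj_on k (X' - g ` X)" "\<And>x. x \<in> X' - g ` X \<Longrightarrow> k x \<in> Y - f ` X"
      "\<And>x. x \<in> X' - g ` X \<Longrightarrow> lab (k x) = lab x" by (auto simp: lab_inj_def PiE_def Pi_def)
    define b where "b = restrict (\<lambda>x. if x \<in> g ` X then f (the_inv_into X g x) else k x) X'"
    have bg: "b (g x) = f x" if "x \<in> X" for x
      using that gX by (auto simp: b_def the_inv_into_f_f)
    have bk: "b x = k x" if "x \<in> X' - g ` X" for x using that by (auto simp: b_def)
    have split: "(\<exists>y\<in>X. x = g y) \<or> x \<in> X' - g ` X" if "x \<in> X'" for x using that by blast
    have "inj_on b X'"
    proof (rule inj_onI)
      fix x y assume xy: "x \<in> X'" "y \<in> X'" "b x = b y"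
      consider (ff) a c where "a \<in> X" "x = g a" "c \<in> X" "y = g c"
        | (fk) a where "a \<in> X" "x = g a" "y \<in> X' - g ` X"
        | (kf) c where "x \<in> X' - g ` X" "c \<in> X" "y = g c"
        | (kk) "x \<in> X' - g ` X" "y \<in> X' - g ` X"
        using split[OF xy(1)] split[OF xy(2)] by blast
      then show "x = y"
      proof cases
        case ff then show ?thesis using xy(3) bg fX(1) by (simp add: inj_on_eq_iff)
      next
        case fk then show ?thesis using xy(3) bg[of a] bk[of y] k(2)[of y] imageI[of a X f] by simp
      next
        case kf then show ?thesis using xy(3) bg[of c] bk[of x] k(2)[of x] imageI[of c X f] by simp
      next
        case kk then show ?thesis using xy(3) bk[of x] bk[of y] inj_onD[OF k(1)] by simp
      qed
    qed
    moreover have "b x \<in> Y \<and> lab (b x) = lab x" if "x \<in> X'" for x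
      using split[OF that] bg bk k fX gX by auto
    ultimately have "b \<in> lab_inj lab X' Y" by (auto simp: lab_inj_def b_def)
    moreover have "f = restrict (b \<circ> g) X" using bg fX(4) by (auto simp: fun_eq_iff restrict_def)
    ultimately show "f \<in> (\<lambda>b. restrict (b \<circ> g) X) ` lab_inj lab X' Y" by blast
  qed
  then have "card (lab_inj lab X Y) \<le> card ((\<lambda>b. restrict (b \<circ> g) X) ` lab_inj lab X' Y)"
    using finite_lab_inj[OF fin(2,3)] by (intro card_mono) auto
  also have "\<dots> \<le> card (lab_inj lab X' Y)" by (intro card_image_le finite_lab_inj fin)
  finally show ?thesis .
qed

text \<open>\<open>z\<close> maps \<open>S - {p}\<close> bijectively onto \<open>T - {z p}\<close>.
  From this count the degree defects of a near-perfect matching are read off.\<close>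

lemma permutes_card_shift:
  assumes z: "z permutes A" and fin: "finite A" and p: "p \<in> A" and ST: "S \<subseteq> A" "T \<subseteq> A"
    and iff: "\<And>a. a \<in> A \<Longrightarrow> a \<noteq> p \<Longrightarrow> a \<in> S \<longleftrightarrow> z a \<in> T"
  shows "card S + of_bool (z p \<in> T) = card T + of_bool (p \<in> S)"
proof -
  have "z ` (S - {p}) = T - {z p}"
  proof
    show "z ` (S - {p}) \<subseteq> T - {z p}" using iff ST permutes_inj[OF z] by (auto dest: injD)
    show "T - {z p} \<subseteq> z ` (S - {p})"
    proof
      fix y assume y: "y \<in> T - {z p}"
      then obtain a where a: "a \<in> A" "y = z a" using ST permutes_image[OF z] by blast
      then show "y \<in> z ` (S - {p})" using y iff by blast
    qed
  qed
  then have "card (S - {p}) = card (T - {z p})"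
    using card_image[OF inj_on_subset[OF permutes_inj[OF z]], of "S - {p}"] by simp
  moreover have split: "card X = card (X - {x}) + of_bool (x \<in> X)" if "X \<subseteq> A" for X x
    using card_Suc_Diff1[of X x] finite_subset[OF that fin] by auto
  ultimately show ?thesis using split[OF ST(1), of p] split[OF ST(2), of "z p"] by linarith
qed

section \<open>The auxiliary bipartite graph and the degree defects of its matchings\<close>

type_synonym node = "(nat \<times> nat) + (nat \<times> nat)"

text \<open>Adjacency between an argument copy and a value copy of the nodes. As a value a slot
  stands for its row, as an argument for its column, which is why the two mixed cases compare
  different coordinates.\<close>

fun allowed :: "node \<Rightarrow> node \<Rightarrow> bool" where
  "allowed (Inl c) (Inl c') = (c = c')"
| "allowed (Inl c) (Inr y) = (fst c = fst y)"
| "allowed (Inr y) (Inl c) = (snd c = snd y)"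
| "allowed (Inr y) (Inr y') = False"

definition fixed_cells :: "(node \<Rightarrow> node) \<Rightarrow> (nat \<times> nat) set \<Rightarrow> (nat \<times> nat) set" where
  "fixed_cells z C = {c \<in> C. z (Inl c) = Inl c}"

lemma fixed_cells_transpose:
  "hamming (fixed_cells z C) (fixed_cells (z \<circ> transpose p q) C) \<le> 2"
proof (rule hamming_le_cover)
  let ?D = "Inl -` {p, q} :: (nat \<times> nat) set"
  have "inj (Inl :: nat \<times> nat \<Rightarrow> node)" by simp
  then show "finite ?D" by (intro finite_vimageI) auto
  have "card ?D = card ((Inl :: _ \<Rightarrow> node) ` ?D)" by (rule card_image[symmetric]) simp
  also have "\<dots> \<le> card {p, q}" by (intro card_mono) auto
  finally show "card ?D \<le> 2" by (simp add: card_insert_if split: if_splits)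
  show "fixed_cells z C - ?D = fixed_cells (z \<circ> transpose p q) C - ?D"
    by (auto simp: fixed_cells_def transpose_def)
qed

lemma card_row_cells: "i < n \<Longrightarrow> H \<subseteq> {0..<n} \<times> {0..<m} \<Longrightarrow>
    card {c \<in> {0..<n} \<times> {0..<m} - H. fst c = i} + row_degree H i = m"
proof -
  assume i: "i < n" and H: "H \<subseteq> {0..<n} \<times> {0..<m}"
  have "{c \<in> {0..<n} \<times> {0..<m} - H. fst c = i} = Pair i ` ({0..<m} - {j. (i, j) \<in> H})" using i by auto
  then have "card {c \<in> {0..<n} \<times> {0..<m} - H. fst c = i} = card ({0..<m} - {j. (i, j) \<in> H})"
    by (simp add: card_image inj_on_def)
  moreover have "{j. (i, j) \<in> H} \<subseteq> {0..<m}" using H by auto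
  ultimately show ?thesis
    using card_mono[of "{0..<m}" "{j. (i, j) \<in> H}"] by (simp add: row_degree_def card_Diff_subset finite_subset)
qed

lemma card_col_cells: "j < m \<Longrightarrow> H \<subseteq> {0..<n} \<times> {0..<m} \<Longrightarrow>
    card {c \<in> {0..<n} \<times> {0..<m} - H. snd c = j} + col_degree H j = n"
proof -
  assume j: "j < m" and H: "H \<subseteq> {0..<n} \<times> {0..<m}"
  have "{c \<in> {0..<n} \<times> {0..<m} - H. snd c = j} = (\<lambda>i. (i, j)) ` ({0..<n} - {i. (i, j) \<in> H})" using j by auto
  then have "card {c \<in> {0..<n} \<times> {0..<m} - H. snd c = j} = card ({0..<n} - {i. (i, j) \<in> H})"
    by (simp add: card_image inj_on_def)
  moreover have "{i. (i, j) \<in> H} \<subseteq> {0..<n}" using H by auto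
  ultimately show ?thesis
    using card_mono[of "{0..<n}" "{i. (i, j) \<in> H}"] by (simp add: col_degree_def card_Diff_subset finite_subset)
qed

text \<open>The auxiliary graph: an edge \<open>c\<close> of a realization is a fixed point \<open>Inl c\<close>; a non-edge \<open>c = (i, j)\<close> is mapped
  to one of the \<open>m - du i\<close> slots of row \<open>i\<close> and is the image of one of the \<open>n - dv j\<close> slots of column
  \<open>j\<close>. The non-edges of an arbitrary realization \<open>G0\<close> serve as slots for both purposes.\<close>

locale lifted_realizations = stable_degrees +
  fixes G0 :: "(nat \<times> nat) set"
  assumes G0: "G0 \<in> realizations n m du dv"
begin

definition cells :: "(nat \<times> nat) set" where "cells = {0..<n} \<times> {0..<m}"

definition slots :: "(nat \<times> nat) set" where "slots = cells - G0"

definition nodes :: "node set" where "nodes = Inl ` cells \<union> Inr ` slots"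

abbreviation perfects :: "(node \<Rightarrow> node) set" where "perfects \<equiv> perfect nodes allowed"

abbreviation nears :: "(node \<Rightarrow> node) set" where "nears \<equiv> near_perfect nodes allowed"

abbreviation graph_of :: "(node \<Rightarrow> node) \<Rightarrow> (nat \<times> nat) set" where "graph_of z \<equiv> fixed_cells z cells"

definition weight :: nat where "weight = card (lab_inj fst slots slots) * card (lab_inj snd slots slots)"

lemma finite_cells: "finite cells" "finite slots" "finite nodes"
  by (simp_all add: cells_def slots_def nodes_def)

lemma card_slots_row:
  assumes "i < n" "H \<subseteq> cells"
  shows "card {c \<in> cells - H. fst c = i} + row_degree H i = card {c \<in> slots. fst c = i} + du i"
  using card_row_cells[of i n H m] card_row_cells[of i n G0 m] assms G0
  by (simp add: cells_def slots_def mem_realizations)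

lemma card_slots_col:
  assumes "j < m" "H \<subseteq> cells"
  shows "card {c \<in> cells - H. snd c = j} + col_degree H j = card {c \<in> slots. snd c = j} + dv j"
  using card_col_cells[of j m H n] card_col_cells[of j m G0 n] assms G0
  by (simp add: cells_def slots_def mem_realizations)

context
  fixes z p
  assumes z: "z permutes nodes" and p: "p \<in> nodes" and good: "\<And>a. a \<in> nodes - {p} \<Longrightarrow> allowed a (z a)"
begin

lemma z_node: "a \<in> nodes \<Longrightarrow> z a \<in> nodes"
  using z by (simp add: permutes_in_image)

lemma fixed_iff: "z a = Inl c \<Longrightarrow> c \<in> graph_of z \<Longrightarrow> a = Inl c"
  using injD[OF permutes_inj[OF z], of a "Inl c"] by (simp add: fixed_cells_def)

text \<open>Away from \<open>p\<close>, a cell of row \<open>i\<close> is a non-edge iff its value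
  is a slot of row \<open>i\<close>. Hence a bad argument that is a non-edge cell costs its row one
  degree, and a bad value that is a slot adds one to its row.\<close>

lemma row_shift:
  assumes "i < n"
  shows "row_degree (graph_of z) i + of_bool (\<exists>c\<in>cells - graph_of z. p = Inl c \<and> fst c = i)
    = du i + of_bool (\<exists>y\<in>slots. z p = Inr y \<and> fst y = i)"
proof -
  let ?S = "Inl ` {c \<in> cells - graph_of z. fst c = i} :: node set" and ?T = "Inr ` {c \<in> slots. fst c = i} :: node set"
  have "card ?S + of_bool (z p \<in> ?T) = card ?T + of_bool (p \<in> ?S)"
  proof (rule permutes_card_shift[OF z finite_cells(3) p])
    fix a assume a: "a \<in> nodes" "a \<noteq> p"
    have "z a \<in> nodes" using a z_node by blast
    then show "a \<in> ?S \<longleftrightarrow> z a \<in> ?T"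
      using good[of a] a by (cases a; cases "z a") (auto simp: nodes_def fixed_cells_def)
  qed (auto simp: nodes_def)
  moreover have "card ?S = card {c \<in> cells - graph_of z. fst c = i}" "card ?T = card {c \<in> slots. fst c = i}"
    by (simp_all add: card_image)
  moreover have in_iff: "p \<in> ?S \<longleftrightarrow> (\<exists>c\<in>cells - graph_of z. p = Inl c \<and> fst c = i)"
    "z p \<in> ?T \<longleftrightarrow> (\<exists>y\<in>slots. z p = Inr y \<and> fst y = i)" by blast+
  moreover have "graph_of z \<subseteq> cells" by (auto simp: fixed_cells_def)
  ultimately show ?thesis
    unfolding in_iff[symmetric] using card_slots_row[OF assms, of "graph_of z"]
    by linarith
qed

lemma col_shift:
  assumes "j < m"
  shows "col_degree (graph_of z) j + of_bool (\<exists>c\<in>cells - graph_of z. z p = Inl c \<and> snd c = j)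
    = dv j + of_bool (\<exists>y\<in>slots. p = Inr y \<and> snd y = j)"
proof -
  let ?T = "Inl ` {c \<in> cells - graph_of z. snd c = j} :: node set" and ?S = "Inr ` {c \<in> slots. snd c = j} :: node set"
  have "card ?S + of_bool (z p \<in> ?T) = card ?T + of_bool (p \<in> ?S)"
  proof (rule permutes_card_shift[OF z finite_cells(3) p])
    fix a assume a: "a \<in> nodes" "a \<noteq> p"
    have "z a \<in> nodes" using a z_node by blast
    then show "a \<in> ?S \<longleftrightarrow> z a \<in> ?T"
      using good[of a] a fixed_iff[of a] by (cases a; cases "z a") (auto simp: nodes_def fixed_cells_def)
  qed (auto simp: nodes_def)
  moreover have "card ?T = card {c \<in> cells - graph_of z. snd c = j}" "card ?S = card {c \<in> slots. snd c = j}"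
    by (simp_all add: card_image)
  moreover have in_iff: "p \<in> ?S \<longleftrightarrow> (\<exists>y\<in>slots. p = Inr y \<and> snd y = j)"
    "z p \<in> ?T \<longleftrightarrow> (\<exists>c\<in>cells - graph_of z. z p = Inl c \<and> snd c = j)" by blast+
  moreover have "graph_of z \<subseteq> cells" by (auto simp: fixed_cells_def)
  ultimately show ?thesis
    unfolding in_iff[symmetric] using card_slots_col[OF assms, of "graph_of z"]
    by linarith
qed

text \<open>The kinds of \<open>p\<close> and \<open>z p\<close> decide the defect: cell to cell
  gives a deficit on both sides or none, cell to slot an imbalance of rows, slot to cell one of
  columns, and slot to slot a surplus on both sides.\<close>

lemma repair_fixed_cells: "\<exists>G\<in>realizations n m du dv. hamming (graph_of z) G \<le> 9"
proof -
  have HC: "graph_of z \<subseteq> {0..<n} \<times> {0..<m}" by (auto simp: fixed_cells_def cells_def)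
  show ?thesis
  proof (cases p; cases "z p")
    fix c c' assume pc: "p = Inl c" "z p = Inl c'"
    have cc: "c \<in> cells" "c' \<in> cells" using p z_node[OF p] pc by (auto simp: nodes_def)
    show ?thesis
    proof (cases "c \<in> graph_of z")
      case True
      have "c' = c" using True pc by (simp add: fixed_cells_def)
      then have "graph_of z \<in> realizations n m du dv"
        using HC row_shift col_shift True pc by (simp add: mem_realizations)
      then show ?thesis by force
    next
      case False
      then have c': "c' \<notin> graph_of z" using fixed_iff[OF pc(2)] pc(1) by auto
      have "row_degree (graph_of z) i + of_bool (i = fst c) = du i" if "i < n" for i
        using row_shift[OF that] pc cc False by (simp add: eq_commute[of i])
      moreover have "col_degree (graph_of z) j + of_bool (j = snd c') = dv j" if "j < m" for j
        using col_shift[OF that] pc cc c' by (simp add: eq_commute[of j])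
      ultimately have "\<exists>G\<in>realizations n m du dv. hamming (graph_of z) G \<le> 7"
        using HC cc by (intro repair_deficit[of _ "fst c" "snd c'"]) (auto simp: cells_def)
      then show ?thesis by force
    qed
  next
    fix c y assume pc: "p = Inl c" "z p = Inr y"
    have cc: "c \<in> cells" "y \<in> slots" "y \<in> cells" using p z_node[OF p] pc by (auto simp: nodes_def slots_def)
    have c: "c \<notin> graph_of z" using pc by (auto simp: fixed_cells_def)
    have "row_degree (graph_of z) i + of_bool (i = fst c) = du i + of_bool (i = fst y)" if "i < n" for i
      using row_shift[OF that] pc cc c by (simp add: eq_commute[of i])
    moreover have "col_degree (graph_of z) j = dv j" if "j < m" for j
      using col_shift[OF that] pc by simp
    ultimately have "\<exists>G\<in>realizations n m du dv. hamming (graph_of z) G \<le> 8"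
      using HC cc by (intro repair_rows[of _ "fst c" "fst y"]) (auto simp: cells_def)
    then show ?thesis by force
  next
    fix y c assume pc: "p = Inr y" "z p = Inl c"
    have cc: "c \<in> cells" "y \<in> slots" "y \<in> cells" using p z_node[OF p] pc by (auto simp: nodes_def slots_def)
    have c: "c \<notin> graph_of z" using fixed_iff[OF pc(2)] pc(1) by auto
    have "row_degree (graph_of z) i = du i" if "i < n" for i
      using row_shift[OF that] pc by simp
    moreover have "col_degree (graph_of z) j + of_bool (j = snd c) = dv j + of_bool (j = snd y)" if "j < m" for j
      using col_shift[OF that] pc cc c by (simp add: eq_commute[of j])
    ultimately have "\<exists>G\<in>realizations n m du dv. hamming (graph_of z) G \<le> 8"
      using HC cc by (intro repair_cols[of _ "snd c" "snd y"]) (auto simp: cells_def)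
    then show ?thesis by force
  next
    fix y y' assume pc: "p = Inr y" "z p = Inr y'"
    have cc: "y \<in> slots" "y' \<in> slots" "y \<in> cells" "y' \<in> cells"
      using p z_node[OF p] pc by (auto simp: nodes_def slots_def)
    have "row_degree (graph_of z) i = du i + of_bool (i = fst y')" if "i < n" for i
      using row_shift[OF that] pc cc by (simp add: eq_commute[of i])
    moreover have "col_degree (graph_of z) j = dv j + of_bool (j = snd y)" if "j < m" for j
      using col_shift[OF that] pc cc by (simp add: eq_commute[of j])
    ultimately show ?thesis
      using HC cc by (intro repair_surplus[of _ "fst y'" "snd y"]) (auto simp: cells_def)
  qed
qed

lemma lab_inj_rows:
  "restrict (\<lambda>c. projr (z (Inl c))) {c \<in> cells - graph_of z. Inl c \<noteq> p} \<in> lab_inj fst {c \<in> cells - graph_of z. Inl c \<noteq> p} slots"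
  and row_image: "c \<in> cells \<Longrightarrow> c \<notin> graph_of z \<Longrightarrow> Inl c \<noteq> p \<Longrightarrow> z (Inl c) = Inr (projr (z (Inl c)))"
proof -
  have *: "\<exists>y\<in>slots. z (Inl c) = Inr y \<and> fst y = fst c" if "c \<in> cells" "c \<notin> graph_of z" "Inl c \<noteq> p" for c
    using good[of "Inl c"] z_node[of "Inl c"] that
    by (cases "z (Inl c)") (auto simp: nodes_def fixed_cells_def)
  show "z (Inl c) = Inr (projr (z (Inl c)))" if "c \<in> cells" "c \<notin> graph_of z" "Inl c \<noteq> p" for c
    using *[OF that] by force
  have "inj_on (\<lambda>c. projr (z (Inl c))) {c \<in> cells - graph_of z. Inl c \<noteq> p}"
  proof (rule inj_onI)
    fix c c' assume "c \<in> {c \<in> cells - graph_of z. Inl c \<noteq> p}" "c' \<in> {c \<in> cells - graph_of z. Inl c \<noteq> p}"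
      "projr (z (Inl c)) = projr (z (Inl c'))"
    then have "z (Inl c) = z (Inl c')" using *[of c] *[of c'] by force
    then show "c = c'" using permutes_inj[OF z] by (auto dest: injD)
  qed
  then show "restrict (\<lambda>c. projr (z (Inl c))) {c \<in> cells - graph_of z. Inl c \<noteq> p} \<in> lab_inj fst {c \<in> cells - graph_of z. Inl c \<noteq> p} slots"
    using * by (force simp: lab_inj_def)
qed

lemma lab_inj_cols:
  "restrict (\<lambda>c. projr (inv z (Inl c))) {c \<in> cells - graph_of z. Inl c \<noteq> z p} \<in> lab_inj snd {c \<in> cells - graph_of z. Inl c \<noteq> z p} slots"
  and col_image: "c \<in> cells \<Longrightarrow> c \<notin> graph_of z \<Longrightarrow> Inl c \<noteq> z p \<Longrightarrow> inv z (Inl c) = Inr (projr (inv z (Inl c)))"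
proof -
  have *: "\<exists>y\<in>slots. inv z (Inl c) = Inr y \<and> snd y = snd c" if c: "c \<in> cells" "c \<notin> graph_of z" "Inl c \<noteq> z p" for c
  proof -
    have zi: "z (inv z (Inl c)) = Inl c" using z by (simp add: permutes_inverses)
    have "inv z (Inl c) \<in> nodes" 
      using z c by (simp add: permutes_in_image permutes_inv) (simp add: nodes_def)
    moreover have "inv z (Inl c) \<noteq> p" using zi c by metis
    ultimately show ?thesis using good[of "inv z (Inl c)"] zi c
      by (cases "inv z (Inl c)") (auto simp: nodes_def fixed_cells_def)
  qed
  show "inv z (Inl c) = Inr (projr (inv z (Inl c)))" if "c \<in> cells" "c \<notin> graph_of z" "Inl c \<noteq> z p" for c
    using *[OF that] by force
  have "inj_on (\<lambda>c. projr (inv z (Inl c))) {c \<in> cells - graph_of z. Inl c \<noteq> z p}"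
  proof (rule inj_onI)
    fix c c' assume "c \<in> {c \<in> cells - graph_of z. Inl c \<noteq> z p}" "c' \<in> {c \<in> cells - graph_of z. Inl c \<noteq> z p}"
      "projr (inv z (Inl c)) = projr (inv z (Inl c'))"
    then have "inv z (Inl c) = inv z (Inl c')" using *[of c] *[of c'] by force
    then show "c = c'" using permutes_inj[OF permutes_inv[OF z]] by (auto dest: injD)
  qed
  then show "restrict (\<lambda>c. projr (inv z (Inl c))) {c \<in> cells - graph_of z. Inl c \<noteq> z p} \<in> lab_inj snd {c \<in> cells - graph_of z. Inl c \<noteq> z p} slots"
    using * by (force simp: lab_inj_def)
qed

end

text \<open>Once the graph and the bad pair are fixed, \<open>z\<close> is determined by its values
  on the remaining non-edge cells, a row-preserving injection into the slots, and by its inverse on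
  such cells, a column-preserving one.\<close>

lemma near_fibre_piece:
  assumes p: "p \<in> nodes"
  shows "card {z. z permutes nodes \<and> (\<forall>a\<in>nodes-{p}. allowed a (z a)) \<and> graph_of z = H \<and> z p = b} \<le> weight"
    (is "card ?Z \<le> _")
proof -
  let ?X1 = "{c \<in> cells - H. Inl c \<noteq> p}" and ?X2 = "{c \<in> cells - H. Inl c \<noteq> b}"
  let ?\<phi> = "\<lambda>z. (restrict (\<lambda>c. projr (z (Inl c))) ?X1, restrict (\<lambda>c. projr (inv z (Inl c))) ?X2)"
  have "inj_on ?\<phi> ?Z"
  proof (rule inj_onI)
    fix z z' assume zz: "z \<in> ?Z" "z' \<in> ?Z" "?\<phi> z = ?\<phi> z'"
    have perm: "z permutes nodes" "z' permutes nodes" and zp: "z p = b" "z' p = b"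
      and fx: "graph_of z = H" "graph_of z' = H"
      and good: "\<And>a. a \<in> nodes - {p} \<Longrightarrow> allowed a (z a)" "\<And>a. a \<in> nodes - {p} \<Longrightarrow> allowed a (z' a)"
      using zz by auto
    have r: "restrict (\<lambda>c. projr (z (Inl c))) ?X1 = restrict (\<lambda>c. projr (z' (Inl c))) ?X1"
      "restrict (\<lambda>c. projr (inv z (Inl c))) ?X2 = restrict (\<lambda>c. projr (inv z' (Inl c))) ?X2"
      using zz(3) by blast+
    have eq1: "projr (z (Inl c)) = projr (z' (Inl c))" if "c \<in> ?X1" for c
      using fun_cong[OF r(1), of c] that by simp
    have eq2: "projr (inv z (Inl c)) = projr (inv z' (Inl c))" if "c \<in> ?X2" for c
      using fun_cong[OF r(2), of c] that by simp
    show "z = z'"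
    proof
      fix a
      consider "a \<notin> nodes" | "a = p" | c where "a = Inl c" "c \<in> cells" "a \<noteq> p" | y where "a = Inr y" "y \<in> slots" "a \<noteq> p"
        unfolding nodes_def by blast
      then show "z a = z' a"
      proof cases
        case 1 then show ?thesis using perm by (simp add: permutes_not_in)
      next
        case 2 then show ?thesis using zp by simp
      next
        case (3 c)
        show ?thesis
        proof (cases "c \<in> H")
          case True
          then have "c \<in> graph_of z" "c \<in> graph_of z'" using fx by simp_all
          then show ?thesis using 3(1) by (simp add: fixed_cells_def)
        next
          case False
          then show ?thesis
            using row_image[OF perm(1) p good(1), of c] row_image[OF perm(2) p good(2), of c] fx 3 eq1[of c] by auto
        qed
      next
        \<comment> \<open>Slots as arguments are recovered through the inverse: the value of a slot
          is a non-edge cell different from \<open>b\<close>, where the inverses of \<open>z\<close>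
          and \<open>z'\<close> agree.\<close>
        case (4 y)
        have a: "a \<in> nodes" using 4 by (simp add: nodes_def)
        have "z a \<in> nodes" "allowed a (z a)" using a perm good 4 by (auto simp: permutes_in_image)
        then obtain c where c: "z a = Inl c" "c \<in> cells" using 4 by (cases "z a") (auto simp: nodes_def)
        have "c \<notin> H" using fixed_iff[OF perm(1) p good(1), of a c] c 4 fx by auto
        moreover have cb: "Inl c \<noteq> b" using c zp 4 permutes_inj[OF perm(1)] by (metis injD)
        ultimately have "inv z' (Inl c) = inv z (Inl c)"
          using col_image[OF perm(1) p good(1), of c] col_image[OF perm(2) p good(2), of c] fx c zp eq2[of c] by auto
        also have "inv z (Inl c) = a" using c perm by (metis permutes_inverses(2))
        finally show ?thesis using c perm by (metis permutes_inverses(1))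
      qed
    qed
  qed
  moreover have "?\<phi> ` ?Z \<subseteq> lab_inj fst ?X1 slots \<times> lab_inj snd ?X2 slots"
  proof
    fix x assume "x \<in> ?\<phi> ` ?Z"
    then obtain z where z: "z \<in> ?Z" "x = ?\<phi> z" by blast
    then show "x \<in> lab_inj fst ?X1 slots \<times> lab_inj snd ?X2 slots"
      using lab_inj_rows[of z p] lab_inj_cols[of z p] p by auto
  qed
  ultimately have "card ?Z \<le> card (lab_inj fst ?X1 slots \<times> lab_inj snd ?X2 slots)"
    using finite_cells by (intro card_inj_on_le finite_cartesian_product finite_lab_inj) auto
  also have "\<dots> \<le> weight" unfolding card_cartesian_product weight_def
    using finite_cells by (intro mult_mono card_lab_inj_le) auto
  finally show ?thesis .
qed

lemma near_fibre_le:
  "card {z \<in> nears. graph_of z = H} \<le> card nodes ^ 2 * weight"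
proof -
  let ?Z = "\<lambda>p b. {z. z permutes nodes \<and> (\<forall>a\<in>nodes-{p}. allowed a (z a)) \<and> graph_of z = H \<and> z p = b}"
  have "{z \<in> nears. graph_of z = H} \<subseteq> (\<Union>(p, b)\<in>nodes \<times> nodes. ?Z p b)"
  proof
    fix z assume "z \<in> {z \<in> nears. graph_of z = H}"
    then obtain p where "p \<in> nodes" "z \<in> ?Z p (z p)" "z p \<in> nodes"
      by (auto simp: near_perfect_def permutes_in_image)
    then show "z \<in> (\<Union>(p, b)\<in>nodes \<times> nodes. ?Z p b)" by blast
  qed
  moreover have "finite (\<Union>(p, b)\<in>nodes \<times> nodes. ?Z p b)"
    using finite_cells by (auto intro: finite_subset[OF _ finite_permutations[OF finite_cells(3)]])
  ultimately have "card {z \<in> nears. graph_of z = H} \<le> card (\<Union>(p, b)\<in>nodes \<times> nodes. ?Z p b)"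
    by (rule card_mono[rotated])
  also have "\<dots> \<le> (\<Sum>(p, b)\<in>nodes \<times> nodes. card (?Z p b))"
    using card_UN_le[of "nodes \<times> nodes" "\<lambda>(p, b). ?Z p b"] finite_cells by (simp add: case_prod_beta)
  also have "\<dots> \<le> (\<Sum>(p, b)\<in>nodes \<times> nodes. weight)"
    using near_fibre_piece by (intro sum_mono) auto
  finally show ?thesis by (simp add: power2_eq_square card_cartesian_product case_prod_beta)
qed

text \<open>\<open>G\<close> leaves as many non-edges in each row and column as there are slots. So
  every row-preserving \<open>f\<close> and column-preserving \<open>g\<close> from the non-edges to
  the slots are bijections, and sending non-edges along \<open>f\<close> and slots back along
  \<open>g\<close> gives an encoding of \<open>G\<close> from which both can be recovered.\<close>

lemma perfect_fibre_ge:
  assumes G: "G \<in> realizations n m du dv"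
  shows "weight \<le> card {z \<in> perfects. graph_of z = G}" (is "_ \<le> card ?Z")
proof -
  let ?X = "cells - G"
  have GC: "G \<subseteq> cells" using G by (simp add: mem_realizations cells_def)
  have rows: "card {c \<in> ?X. fst c = i} = card {c \<in> slots. fst c = i}" for i
  proof (cases "i < n")
    case True then show ?thesis using card_slots_row[OF True GC] G by (simp add: mem_realizations)
  next
    case False
    then have "{c \<in> ?X. fst c = i} = {}" "{c \<in> slots. fst c = i} = {}" by (auto simp: cells_def slots_def)
    then show ?thesis by (simp only:)
  qed
  have cols: "card {c \<in> ?X. snd c = j} = card {c \<in> slots. snd c = j}" for j
  proof (cases "j < m")
    case True then show ?thesis using card_slots_col[OF True GC] G by (simp add: mem_realizations)
  next
    case False
    then have "{c \<in> ?X. snd c = j} = {}" "{c \<in> slots. snd c = j} = {}" by (auto simp: cells_def slots_def)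
    then show ?thesis by (simp only:)
  qed
  have fX: "finite ?X" using finite_cells by simp
  have eq_card: "card ?X = card slots"
  proof -
    obtain h where "h \<in> lab_inj fst ?X slots" using lab_inj_exists[OF fX finite_cells(2), of fst] rows by auto
    moreover obtain h' where "h' \<in> lab_inj fst slots ?X" using lab_inj_exists[OF finite_cells(2) fX, of fst] rows by auto
    ultimately show ?thesis using fX finite_cells
      by (intro antisym card_inj_on_le[of h] card_inj_on_le[of h']) (auto simp: lab_inj_def)
  qed
  have bij: "bij_betw f ?X slots" if "f \<in> lab_inj lab ?X slots" for f and lab :: "nat \<times> nat \<Rightarrow> nat"
    using that finite_cells eq_card card_subset_eq[of slots "f ` ?X"]
    by (auto simp: lab_inj_def bij_betw_def card_image)
  define mk :: "(nat \<times> nat \<Rightarrow> nat \<times> nat) \<times> (nat \<times> nat \<Rightarrow> nat \<times> nat) \<Rightarrow> node \<Rightarrow> node" where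
    "mk = (\<lambda>(f, g) a. case a of Inl c \<Rightarrow> if c \<in> ?X then Inr (f c) else Inl c
        | Inr y \<Rightarrow> if y \<in> slots then Inl (the_inv_into ?X g y) else Inr y)"
  let ?L = "lab_inj fst ?X slots \<times> lab_inj snd ?X slots"
  have mem: "mk (f, g) \<in> ?Z" if fg: "f \<in> lab_inj fst ?X slots" "g \<in> lab_inj snd ?X slots" for f g
  proof -
    have f: "bij_betw f ?X slots" and g: "bij_betw g ?X slots" using bij fg by blast+
    have gi: "bij_betw (the_inv_into ?X g) slots ?X" using g by (rule bij_betw_the_inv_into)
    define k where "k = the_inv_into ?X g"
    have mk_Inl: "mk (f, g) (Inl c) = (if c \<in> ?X then Inr (f c) else Inl c)"
      and mk_Inr: "mk (f, g) (Inr y) = (if y \<in> slots then Inl (k y) else Inr y)" for c y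
      by (simp_all add: mk_def k_def)
    have f_inj: "c = c'" if "f c = f c'" "c \<in> ?X" "c' \<in> ?X" for c c'
      using f that by (meson bij_betw_def inj_onD)
    have k_inj: "y = y'" if "k y = k y'" "y \<in> slots" "y' \<in> slots" for y y'
      using gi that unfolding k_def by (meson bij_betw_def inj_onD)
    have f_mem: "f c \<in> slots" if "c \<in> ?X" for c using bij_betwE[OF f] that by blast
    have k_mem: "k y \<in> ?X" if "y \<in> slots" for y using bij_betwE[OF gi] that unfolding k_def by blast
    have "mk (f, g) permutes nodes"
    proof (rule inj_imp_permutes)
      show "inj_on (mk (f, g)) nodes"
      proof (rule inj_onI)
        fix a b assume ab: "a \<in> nodes" "b \<in> nodes" "mk (f, g) a = mk (f, g) b"
        show "a = b"
        proof (cases a; cases b)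
          fix c c' assume "a = Inl c" "b = Inl c'"
          then show ?thesis using ab(3) f_inj[of c c'] by (simp add: mk_Inl split: if_splits)
        next
          fix c y assume c: "a = Inl c" "b = Inr y"
          then have "y \<in> slots" using ab(2) by (auto simp: nodes_def)
          then show ?thesis using ab(3) c k_mem[of y] by (auto simp: mk_Inl mk_Inr split: if_splits)
        next
          fix y c assume c: "a = Inr y" "b = Inl c"
          then have "y \<in> slots" using ab(1) by (auto simp: nodes_def)
          then show ?thesis using ab(3) c k_mem[of y] by (auto simp: mk_Inl mk_Inr split: if_splits)
        next
          fix y y' assume c: "a = Inr y" "b = Inr y'"
          then have "y \<in> slots" "y' \<in> slots" using ab(1,2) by (auto simp: nodes_def)
          then show ?thesis using ab(3) c k_inj[of y y'] by (simp add: mk_Inr)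
        qed
      qed
      show "mk (f, g) x \<in> nodes" if "x \<in> nodes" for x
      proof (cases x)
        case (Inl c)
        then show ?thesis using that f_mem[of c] by (auto simp: mk_Inl nodes_def)
      next
        case (Inr y)
        then show ?thesis using that k_mem[of y] by (auto simp: mk_Inr nodes_def)
      qed
      show "mk (f, g) x = x" if "x \<notin> nodes" for x
        using that by (cases x) (auto simp: mk_Inl mk_Inr nodes_def slots_def)
    qed (rule finite_cells)
    moreover have "allowed a (mk (f, g) a)" if "a \<in> nodes" for a
    proof (cases a)
      case (Inl c)
      then show ?thesis using fg(1) by (auto simp: mk_def lab_inj_def)
    next
      case (Inr y)
      then have y: "y \<in> slots" using that by (auto simp: nodes_def)
      have "g (k y) = y" unfolding k_def using g y by (rule f_the_inv_into_f_bij_betw)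
      moreover have "\<forall>x\<in>?X. snd (g x) = snd x" using fg(2) unfolding lab_inj_def by blast
      ultimately have "snd (k y) = snd y" using k_mem[OF y] by force
      then show ?thesis using Inr y by (simp add: mk_Inr)
    qed
    moreover have "graph_of (mk (f, g)) = G" using GC by (auto simp: fixed_cells_def mk_def)
    ultimately show ?thesis by (auto simp: perfect_def)
  qed
  have "inj_on mk ?L"
  proof (rule inj_onI, clarify)
    fix f g f' g' assume fg: "f \<in> lab_inj fst ?X slots" "g \<in> lab_inj snd ?X slots"
      "f' \<in> lab_inj fst ?X slots" "g' \<in> lab_inj snd ?X slots" "mk (f, g) = mk (f', g')"
    have ext: "u = u'" if "u \<in> lab_inj lab ?X slots" "u' \<in> lab_inj lab ?X slots" "\<And>x. x \<in> ?X \<Longrightarrow> u x = u' x"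
      for u u' and lab :: "nat \<times> nat \<Rightarrow> nat"
      using that by (intro PiE_ext[of u ?X "\<lambda>_. slots" u']) (auto simp: lab_inj_def)
    have "f x = f' x" if "x \<in> ?X" for x
      using fun_cong[OF fg(5), of "Inl x"] that by (auto simp: mk_def)
    then have f: "f = f'" using ext fg by blast
    have g: "bij_betw g ?X slots" "bij_betw g' ?X slots" using bij fg by blast+
    have "g x = g' x" if x: "x \<in> ?X" for x
    proof -
      have y: "g x \<in> slots" using bij_betwE[OF g(1)] x by blast
      have "the_inv_into ?X g (g x) = the_inv_into ?X g' (g x)"
        using fun_cong[OF fg(5), of "Inr (g x)"] y by (simp add: mk_def)
      then have "x = the_inv_into ?X g' (g x)"
        using g(1) x by (simp add: the_inv_into_f_f bij_betw_def)
      then show ?thesis using g(2) y by (metis f_the_inv_into_f_bij_betw)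
    qed
    then have "g = g'" using ext fg by blast
    with f show "f = f' \<and> g = g'" by blast
  qed
  moreover have "mk ` ?L \<subseteq> ?Z" using mem by auto
  moreover have "finite ?Z" using finite_perfect(1)[OF finite_cells(3)] by simp
  ultimately have "card ?L \<le> card ?Z" by (rule card_inj_on_le)
  moreover have "weight \<le> card ?L" unfolding card_cartesian_product weight_def
    using fX finite_cells rows cols by (intro mult_mono card_lab_inj_le) auto
  ultimately show ?thesis by linarith
qed

lemma weight_pos: "weight > 0"
proof -
  have "restrict id slots \<in> lab_inj lab slots slots" for lab :: "nat \<times> nat \<Rightarrow> nat" by (auto simp: lab_inj_def)
  then have "lab_inj lab slots slots \<noteq> {}" for lab :: "nat \<times> nat \<Rightarrow> nat" by blast
  then show ?thesis using finite_lab_inj[OF finite_cells(2,2)] by (auto simp: weight_def card_gt_0_iff)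
qed

end

section \<open>The spectral gap of the swap chain\<close>

context lifted_realizations
begin

abbreviation R :: "(nat \<times> nat) set set" where "R \<equiv> realizations n m du dv"

text \<open>Realizations must be left fixed, so that encodings of \<open>G\<close> project to
  \<open>G\<close> itself. Elsewhere the choice is meaningful only within distance 9 of a
  realization, which \<open>proj_near\<close> ensures for near-perfect matchings.\<close>

definition nearest :: "(nat \<times> nat) set \<Rightarrow> (nat \<times> nat) set" where
  "nearest H = (if H \<in> R then H else (SOME G. G \<in> R \<and> hamming H G \<le> 9))"

definition proj :: "(node \<Rightarrow> node) \<Rightarrow> (nat \<times> nat) set" where
  "proj z = nearest (graph_of z)"

lemma proj_near:
  assumes "z \<in> nears"
  shows "proj z \<in> R" "hamming (graph_of z) (proj z) \<le> 9"
proof -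
  obtain p where "z permutes nodes" "p \<in> nodes" "\<And>a. a \<in> nodes - {p} \<Longrightarrow> allowed a (z a)"
    using assms by (auto simp: near_perfect_def)
  then have "\<exists>G. G \<in> R \<and> hamming (graph_of z) G \<le> 9" using repair_fixed_cells by blast
  then have "proj z \<in> R \<and> hamming (graph_of z) (proj z) \<le> 9"
    unfolding proj_def nearest_def using someI_ex[of "\<lambda>G. G \<in> R \<and> hamming (graph_of z) G \<le> 9"] by auto
  then show "proj z \<in> R" "hamming (graph_of z) (proj z) \<le> 9" by auto
qed

lemma realization_cells: "G \<in> R \<Longrightarrow> G \<subseteq> cells"
  by (simp add: mem_realizations cells_def)

lemma finite_R: "finite R"
  by (rule finite_realizations)

lemma finite_nears: "finite nears" "finite perfects"
  using finite_perfect[OF finite_cells(3)] by auto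

lemma proj_transpose:
  assumes "z \<in> nears" "z \<circ> transpose p q \<in> nears"
  shows "hamming (proj z) (proj (z \<circ> transpose p q)) \<le> 20"
proof -
  let ?z' = "z \<circ> transpose p q"
  have fin: "finite (graph_of z)" "finite (graph_of ?z')" "finite (proj z)" "finite (proj ?z')"
    using finite_cells proj_near assms by (auto simp: fixed_cells_def intro: finite_realization)
  have "hamming (proj z) (proj ?z') \<le> hamming (proj z) (graph_of z) + hamming (graph_of z) (proj ?z')"
    using fin by (intro hamming_triangle)
  also have "hamming (graph_of z) (proj ?z') \<le> hamming (graph_of z) (graph_of ?z') + hamming (graph_of ?z') (proj ?z')"
    using fin by (intro hamming_triangle)
  finally show ?thesis
    using fixed_cells_transpose[of z cells p q] proj_near(2)[OF assms(1)] proj_near(2)[OF assms(2)]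
    by (simp add: hamming_commute)
qed

lemma sum_perfects_ge:
  fixes \<phi> :: "(nat \<times> nat) set \<Rightarrow> real"
  assumes "\<And>G. 0 \<le> \<phi> G"
  shows "real weight * (\<Sum>G\<in>R. \<phi> G) \<le> (\<Sum>z\<in>perfects. \<phi> (proj z))"
proof -
  let ?P = "{z \<in> perfects. graph_of z \<in> R}"
  have "real weight * (\<Sum>G\<in>R. \<phi> G) \<le> (\<Sum>G\<in>R. real (card {z \<in> perfects. graph_of z = G}) * \<phi> G)"
    unfolding sum_distrib_left using perfect_fibre_ge assms by (intro sum_mono mult_right_mono) auto
  also have "\<dots> = (\<Sum>G\<in>R. \<Sum>z\<in>{z \<in> ?P. graph_of z = G}. \<phi> (proj z))"
  proof (rule sum.cong[OF refl])
    fix G assume G: "G \<in> R"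
    then have "{z \<in> ?P. graph_of z = G} = {z \<in> perfects. graph_of z = G}" by auto
    moreover have "(\<Sum>z\<in>{z \<in> perfects. graph_of z = G}. \<phi> (proj z)) = (\<Sum>z\<in>{z \<in> perfects. graph_of z = G}. \<phi> G)"
      using G by (intro sum.cong) (auto simp: proj_def nearest_def)
    ultimately show "real (card {z \<in> perfects. graph_of z = G}) * \<phi> G = (\<Sum>z\<in>{z \<in> ?P. graph_of z = G}. \<phi> (proj z))"
      by simp
  qed
  also have "\<dots> = (\<Sum>z\<in>?P. \<phi> (proj z))" using finite_nears finite_R by (intro sum.group) auto
  also have "\<dots> \<le> (\<Sum>z\<in>perfects. \<phi> (proj z))" using finite_nears assms by (intro sum_mono2) auto
  finally show ?thesis .
qed

lemma variance_le_lifted: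
  fixes f :: "(nat \<times> nat) set \<Rightarrow> real"
  shows "(real weight)\<^sup>2 * (\<Sum>G\<in>R. \<Sum>G'\<in>R. (f G - f G')\<^sup>2)
    \<le> (\<Sum>s\<in>perfects. \<Sum>t\<in>perfects. (f (proj s) - f (proj t))\<^sup>2)"
proof -
  have "(real weight)\<^sup>2 * (\<Sum>G\<in>R. \<Sum>G'\<in>R. (f G - f G')\<^sup>2) = 
      real weight * (\<Sum>G\<in>R. real weight * (\<Sum>G'\<in>R. (f G - f G')\<^sup>2))"
    by (simp add: power2_eq_square mult.assoc flip: sum_distrib_left)
  also have "\<dots> \<le> real weight * (\<Sum>G\<in>R. \<Sum>t\<in>perfects. (f G - f (proj t))\<^sup>2)"
    using sum_perfects_ge[of "\<lambda>G'. (f G - f G')\<^sup>2" for G] by (intro mult_left_mono sum_mono) simp_all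
  also have "\<dots> \<le> (\<Sum>s\<in>perfects. \<Sum>t\<in>perfects. (f (proj s) - f (proj t))\<^sup>2)"
    by (rule sum_perfects_ge) (simp add: sum_nonneg)
  finally show ?thesis .
qed

text \<open>At most \<open>(card cells + 1) ^ 9\<close> graphs lie close enough to project to a
  given realization, and each has at most \<open>card nodes ^ 2 * weight\<close> near-perfect
  encodings.\<close>

definition fibre_bound :: real where
  "fibre_bound = real (card cells + 1) ^ 9 * real (card nodes) ^ 2 * real weight"

lemma card_ball_le:
  assumes "G \<in> R" shows "card {H. H \<subseteq> cells \<and> hamming H G \<le> k} \<le> (card cells + 1) ^ k"
  using card_hamming_ball_le[OF finite_cells(1) realization_cells[OF assms]] .

lemma proj_fibre_le:
  assumes G: "G \<in> R"
  shows "real (card {z \<in> nears. proj z = G}) \<le> fibre_bound"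
proof -
  let ?B = "{H. H \<subseteq> cells \<and> hamming H G \<le> 9}"
  have fB: "finite ?B" by (rule finite_subset[of _ "Pow cells"]) (use finite_cells in auto)
  have "{z \<in> nears. proj z = G} \<subseteq> (\<Union>H\<in>?B. {z \<in> nears. graph_of z = H})"
    using proj_near(2) by (auto simp: fixed_cells_def)
  then have "card {z \<in> nears. proj z = G} \<le> card (\<Union>H\<in>?B. {z \<in> nears. graph_of z = H})"
    using fB finite_nears by (intro card_mono) auto
  also have "\<dots> \<le> (\<Sum>H\<in>?B. card {z \<in> nears. graph_of z = H})" by (rule card_UN_le[OF fB])
  also have "\<dots> \<le> (\<Sum>H\<in>?B. card nodes ^ 2 * weight)" by (intro sum_mono near_fibre_le)
  also have "\<dots> = card ?B * (card nodes ^ 2 * weight)" by simp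
  also have "\<dots> \<le> (card cells + 1) ^ 9 * (card nodes ^ 2 * weight)"
    by (intro mult_right_mono card_ball_le G) simp
  finally have "real (card {z \<in> nears. proj z = G}) \<le> real ((card cells + 1) ^ 9 * (card nodes ^ 2 * weight))"
    by (rule of_nat_mono)
  then show ?thesis by (simp add: fibre_bound_def mult.assoc)
qed

lemma sum_nears_le:
  fixes \<phi> :: "(nat \<times> nat) set \<Rightarrow> real"
  assumes "\<And>G. 0 \<le> \<phi> G"
  shows "(\<Sum>z\<in>nears. \<phi> (proj z)) \<le> fibre_bound * (\<Sum>G\<in>R. \<phi> G)"
proof -
  have "(\<Sum>z\<in>nears. \<phi> (proj z)) = (\<Sum>G\<in>R. \<Sum>z\<in>{z \<in> nears. proj z = G}. \<phi> (proj z))"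
    using finite_nears finite_R proj_near(1) by (intro sum.group[symmetric]) auto
  also have "\<dots> = (\<Sum>G\<in>R. real (card {z \<in> nears. proj z = G}) * \<phi> G)"
    by (intro sum.cong) auto
  also have "\<dots> \<le> (\<Sum>G\<in>R. fibre_bound * \<phi> G)"
    using proj_fibre_le assms by (intro sum_mono mult_right_mono)
  finally show ?thesis by (simp add: sum_distrib_left)
qed

lemma card_nears_le: "real (card nears) \<le> fibre_bound * real (card R)"
  using sum_nears_le[of "\<lambda>_. 1"] by simp

lemma swap_energy_nonneg: "0 \<le> swap_energy X B f"
  unfolding swap_energy_def by (intro sum_nonneg) auto

text \<open>Double counting: the swaps from \<open>G1\<close> are charged only by the realizations
  within distance \<open>k\<close> of \<open>G1\<close>, of which there are polynomially
  many.\<close>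

lemma sum_local_energy_le:
  "(\<Sum>G\<in>R. swap_energy R {G1 \<in> R. hamming G G1 \<le> k} f) \<le> real (card cells + 1) ^ k * swap_energy R R f"
proof -
  define e where "e G1 = (\<Sum>G2\<in>R. if is_swap G1 G2 then (f G1 - f G2)\<^sup>2 else 0)" for G1
  have e0: "0 \<le> e G1" for G1 unfolding e_def by (intro sum_nonneg) auto
  have count: "(\<Sum>G\<in>R. if hamming G G1 \<le> k then e G1 else 0) \<le> real (card cells + 1) ^ k * e G1"
    if G1: "G1 \<in> R" for G1
  proof -
    have "card {G \<in> R. hamming G G1 \<le> k} \<le> card {G. G \<subseteq> cells \<and> hamming G G1 \<le> k}"
    proof (rule card_mono)
      show "finite {G. G \<subseteq> cells \<and> hamming G G1 \<le> k}" using finite_cells(1) by simp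
      show "{G \<in> R. hamming G G1 \<le> k} \<subseteq> {G. G \<subseteq> cells \<and> hamming G G1 \<le> k}"
        using realization_cells by blast
    qed
    also have "\<dots> \<le> (card cells + 1) ^ k" by (rule card_ball_le[OF G1])
    finally have "real (card {G \<in> R. hamming G G1 \<le> k}) \<le> real (card cells + 1) ^ k"
      by (metis of_nat_mono of_nat_power)
    then have "real (card {G \<in> R. hamming G G1 \<le> k}) * e G1 \<le> real (card cells + 1) ^ k * e G1"
      by (rule mult_right_mono[OF _ e0])
    moreover have "(\<Sum>G\<in>R. if hamming G G1 \<le> k then e G1 else 0) = (\<Sum>G\<in>{G \<in> R. hamming G G1 \<le> k}. e G1)"
      by (rule sum.inter_filter[OF finite_R, symmetric])
    ultimately show ?thesis by simp
  qed
  have "(\<Sum>G\<in>R. swap_energy R {G1 \<in> R. hamming G G1 \<le> k} f) = (\<Sum>G\<in>R. \<Sum>G1\<in>R. if hamming G G1 \<le> k then e G1 else 0)"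
    unfolding swap_energy_def e_def[symmetric] by (intro sum.cong refl sum.inter_filter finite_R)
  also have "\<dots> = (\<Sum>G1\<in>R. \<Sum>G\<in>R. if hamming G G1 \<le> k then e G1 else 0)" by (rule sum.swap)
  also have "\<dots> \<le> (\<Sum>G1\<in>R. real (card cells + 1) ^ k * e G1)" by (rule sum_mono[OF count])
  finally show ?thesis by (simp add: swap_energy_def e_def sum_distrib_left)
qed

text \<open>By \<open>proj_transpose\<close> a transposition moves the projection by at most 20, and
  \<open>swap_local_energy\<close> with \<open>h = 20\<close> supplies the factor 400 and the radius
  100.\<close>

lemma lifted_energy_le:
  "transposition_energy nodes nears (f \<circ> proj) \<le> 
     400 * real (card nodes) ^ 2 * fibre_bound * real (card cells + 1) ^ 100 * swap_energy R R f"
proof -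
  let ?\<psi> = "\<lambda>G. swap_energy R {G1 \<in> R. hamming G G1 \<le> 100} f"
  have "transposition_energy nodes nears (f \<circ> proj) \<le> (\<Sum>z\<in>nears. \<Sum>p\<in>nodes. \<Sum>q\<in>nodes. 400 * ?\<psi> (proj z))"
    unfolding transposition_energy_def
  proof (intro sum_mono)
    fix z p q assume z: "z \<in> nears"
    show "(if z \<circ> transpose p q \<in> nears then ((f \<circ> proj) z - (f \<circ> proj) (z \<circ> transpose p q))\<^sup>2 else 0) \<le> 400 * ?\<psi> (proj z)"
    proof (cases "z \<circ> transpose p q \<in> nears")
      case True
      then show ?thesis
        using swap_local_energy[OF refl proj_near(1)[OF z] proj_near(1)[OF True] proj_transpose[OF z True], of f] by simp
    qed (simp add: swap_energy_nonneg)
  qed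
  also have "\<dots> = 400 * real (card nodes) ^ 2 * (\<Sum>z\<in>nears. ?\<psi> (proj z))"
    by (simp add: power2_eq_square mult_ac flip: sum_distrib_left)
  also have "\<dots> \<le> 400 * real (card nodes) ^ 2 * (fibre_bound * (\<Sum>G\<in>R. ?\<psi> G))"
    by (intro mult_left_mono sum_nears_le swap_energy_nonneg) auto
  also have "\<dots> \<le> 400 * real (card nodes) ^ 2 * (fibre_bound * (real (card cells + 1) ^ 100 * swap_energy R R f))"
    by (intro mult_left_mono sum_local_energy_le) (auto simp: fibre_bound_def)
  finally show ?thesis by (simp add: mult_ac)
qed

text \<open>Eleven factors \<open>card nodes\<close> arise: 5 from the matchings, 2 from the choice
  of a transposition and 2 from each of two fibre bounds. Each is at most
  \<open>2 * (card cells + 1)\<close>, so 819200 is 400 times the eleventh power of 2, and 129 = 11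
  + 9 + 9 + 100.\<close>

definition poincare_constant :: real where
  "poincare_constant = 819200 * real (card cells + 1) ^ 129"

lemma card_nodes_le: "card nodes \<le> 2 * (card cells + 1)"
proof -
  have "card nodes \<le> card (Inl ` cells :: node set) + card (Inr ` slots :: node set)"
    unfolding nodes_def by (rule card_Un_le)
  also have "\<dots> = card cells + card slots" by (simp add: card_image)
  also have "card slots \<le> card cells" unfolding slots_def using finite_cells by (intro card_mono) auto
  finally show ?thesis by simp
qed

text \<open>The variance is lifted to pairs of perfect matchings, which gains \<open>weight\<close>
  twice. On the other side \<open>weight\<close> is lost twice, in the number of near-perfect
  matchings and in the lifted energy, so it cancels.\<close>

lemma swap_poincare:
  fixes f :: "(nat \<times> nat) set \<Rightarrow> real"
  shows "(\<Sum>G\<in>R. \<Sum>G'\<in>R. (f G - f G')\<^sup>2) \<le> poincare_constant * real (card R) * swap_energy R R f"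
proof -
  define K s w V E where "K = real (card nodes)" and "s = real (card cells + 1)" and "w = real weight"
    and "V = (\<Sum>G\<in>R. \<Sum>G'\<in>R. (f G - f G')\<^sup>2)" and "E = swap_energy R R f"
  have w: "w > 0" using weight_pos by (simp add: w_def)
  have K: "0 \<le> K" "K \<le> 2 * s" using card_nodes_le by (auto simp: K_def s_def simp del: of_nat_add)
  have s: "0 \<le> s" by (simp add: s_def)
  have E: "0 \<le> E" by (simp add: E_def swap_energy_nonneg)
  have fb: "fibre_bound = s ^ 9 * K ^ 2 * w" by (simp add: fibre_bound_def s_def K_def w_def)
  have fb0: "0 \<le> fibre_bound" using K s w by (simp add: fb)
  have "w\<^sup>2 * V \<le> (\<Sum>s\<in>perfects. \<Sum>t\<in>perfects. (f (proj s) - f (proj t))\<^sup>2)"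
    unfolding w_def V_def by (rule variance_le_lifted)
  also have "\<dots> \<le> K ^ 5 * real (card nears) * transposition_energy nodes nears (f \<circ> proj)"
    using perfect_variance_le_energy[OF finite_cells(3), of "f \<circ> proj" allowed] by (simp add: K_def)
  also have "\<dots> \<le> K ^ 5 * (fibre_bound * real (card R)) * (400 * K ^ 2 * fibre_bound * s ^ 100 * E)"
    using card_nears_le lifted_energy_le[of f] K fb0
    by (intro mult_mono mult_left_mono) 
       (auto simp: K_def s_def E_def transposition_energy_def intro!: sum_nonneg mult_nonneg_nonneg)
  also have "\<dots> = w\<^sup>2 * (400 * K ^ 11 * s ^ 118 * real (card R) * E)"
    by (simp add: fb power_mult_distrib power2_eq_square eval_nat_numeral mult_ac)
  finally have "V \<le> 400 * K ^ 11 * s ^ 118 * real (card R) * E" using w by simp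
  also have "\<dots> \<le> 400 * (2 * s) ^ 11 * s ^ 118 * real (card R) * E"
    using K s E by (intro mult_right_mono mult_left_mono power_mono) auto
  also have "400 * (2 * s) ^ 11 * s ^ 118 = poincare_constant"
    unfolding poincare_constant_def s_def[symmetric] by (simp add: power_mult_distrib flip: power_add)
  finally show ?thesis by (simp add: V_def E_def)
qed

section \<open>The swap chain as a lazy symmetric chain and its mixing time\<close>

definition swap_rate :: real where
  "swap_rate = 1 / (2 * real (n choose 2) * real (m choose 2))"

lemma choose_pos: "0 < n choose 2" "0 < m choose 2"
  using c d by (simp_all add: zero_less_binomial_iff)

lemma swap_rate_bounds: "0 < swap_rate" "swap_rate \<le> 1"
proof -
  show "0 < swap_rate" using choose_pos by (simp add: swap_rate_def)
  have "1 * 1 \<le> real (n choose 2) * real (m choose 2)" using choose_pos by (intro mult_mono) (auto simp: Suc_le_eq)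
  then have "1 \<le> 2 * real (n choose 2) * real (m choose 2)" unfolding mult.assoc by linarith
  moreover have "1 / x \<le> 1" if "1 \<le> x" for x :: real using that by simp
  ultimately show "swap_rate \<le> 1" unfolding swap_rate_def by blast
qed

lemma swap_P_eq: "swap_P n m du dv G G' = 
    (if G' = G then 1 - swap_rate * real (card {H \<in> R. is_swap G H}) else if is_swap G G' then swap_rate else 0)"
proof -
  have "{H \<in> R. H \<noteq> G \<and> is_swap G H} = {H \<in> R. is_swap G H}" using is_swap_irrefl by auto
  then show ?thesis by (simp add: swap_P_def swap_rate_def Let_def)
qed

text \<open>A swap is recovered from its symmetric difference with \<open>G\<close>, the product of
  a pair of rows and a pair of columns. So each choice of pairs admits at most one swap, which
  yields a holding probability of at least 1/2.\<close>

lemma card_swaps_le: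
  assumes G: "G \<in> R"
  shows "card {H \<in> R. is_swap G H} \<le> (n choose 2) * (m choose 2)"
proof -
  define d where "d H = (G - H) \<union> (H - G)" for H
  let ?T = "{U. U \<subseteq> {0..<n} \<and> card U = 2} \<times> {V. V \<subseteq> {0..<m} \<and> card V = 2}"
  have swap: "d H = fst ` d H \<times> snd ` d H \<and> (fst ` d H, snd ` d H) \<in> ?T" if H: "H \<in> R" "is_swap G H" for H
    using H(2)
  proof (rule is_swapE)
    fix u1 u2 v1 v2 assume e: "u1 \<noteq> u2" "v1 \<noteq> v2" "(u1, v1) \<in> G" "(u2, v2) \<in> G" "(u1, v2) \<notin> G" "(u2, v1) \<notin> G"
      "H = (G - {(u1, v1), (u2, v2)}) \<union> {(u1, v2), (u2, v1)}"
    then have D: "d H = {u1, u2} \<times> {v1, v2}" by (auto simp: d_def)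
    then have "fst ` d H = {u1, u2}" "snd ` d H = {v1, v2}" by auto
    moreover have "u1 < n" "u2 < n" "v1 < m" "v2 < m" using realization_cells[OF G] e(3,4) by (auto simp: cells_def)
    ultimately show ?thesis using e(1,2) D by simp
  qed
  define e where "e H = (fst ` d H, snd ` d H)" for H
  let ?X = "{H \<in> R. is_swap G H}"
  have "inj_on e ?X"
  proof (rule inj_onI)
    fix H H' assume H: "H \<in> ?X" "H' \<in> ?X" "e H = e H'"
    then have "d H = fst ` d H \<times> snd ` d H" "d H' = fst ` d H' \<times> snd ` d H'" using swap by blast+
    then have "d H = d H'" using H(3) unfolding e_def by (metis Pair_inject)
    moreover have "H = (G - d H) \<union> (d H - G)" "H' = (G - d H') \<union> (d H' - G)" by (auto simp: d_def)
    ultimately show "H = H'" by metis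
  qed
  moreover have "e H \<in> ?T" if "H \<in> ?X" for H
    using swap[of H] that unfolding e_def by blast
  then have "e ` ?X \<subseteq> ?T" by (rule image_subsetI)
  moreover have "finite ?T" by simp
  ultimately have "card ?X \<le> card ?T" by (rule card_inj_on_le)
  then show ?thesis by (simp add: card_cartesian_product n_subsets)
qed

sublocale chain: lazy_symmetric_chain R "swap_P n m du dv"
proof
  show "finite R" by (rule finite_R)
  show "R \<noteq> {}" using G0 by blast
  show lazy: "1 / 2 \<le> swap_P n m du dv G G" if "G \<in> R" for G
  proof -
    have "swap_rate * real (card {H \<in> R. is_swap G H}) \<le> swap_rate * real ((n choose 2) * (m choose 2))"
      using card_swaps_le[OF that] swap_rate_bounds by (intro mult_left_mono of_nat_mono) auto
    also have "\<dots> = 1 / 2" using choose_pos by (simp add: swap_rate_def)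
    finally show ?thesis by (simp add: swap_P_eq)
  qed
  show "swap_P n m du dv x y = swap_P n m du dv y x" for x y
    using is_swap_sym[of x y] is_swap_sym[of y x] by (auto simp: swap_P_eq)
  show "0 \<le> swap_P n m du dv x y" if "x \<in> R" for x y
    using lazy[OF that] swap_rate_bounds by (cases "x = y") (auto simp: swap_P_eq)
  show "(\<Sum>y\<in>R. swap_P n m du dv x y) = 1" if "x \<in> R" for x
  proof -
    have "(\<Sum>y\<in>R. swap_P n m du dv x y) = 
        (\<Sum>y\<in>R. (if y = x then 1 - swap_rate * real (card {H \<in> R. is_swap x H}) else 0) + (if is_swap x y then swap_rate else 0))"
      using is_swap_irrefl by (intro sum.cong) (auto simp: swap_P_eq)
    also have "\<dots> = 1"
      using that finite_R by (simp add: sum.distrib sum.If_cases Int_def)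
    finally show ?thesis .
  qed
qed

lemma dirichlet_swap: "chain.dirichlet h = swap_rate / 2 * swap_energy R R h"
proof -
  have "(\<Sum>x\<in>R. \<Sum>y\<in>R. swap_P n m du dv x y * (h x - h y)\<^sup>2) = 
      (\<Sum>x\<in>R. \<Sum>y\<in>R. swap_rate * (if is_swap x y then (h x - h y)\<^sup>2 else 0))"
    using is_swap_irrefl by (intro sum.cong) (auto simp: swap_P_eq)
  then show ?thesis by (simp add: chain.dirichlet_def swap_energy_def flip: sum_distrib_left)
qed

text \<open>For a function with sum 0 the squared differences over ordered pairs add up to
  \<open>2 * card R\<close> times its squared norm, and \<open>card R\<close> cancels in
  \<open>swap_poincare\<close>.\<close>

lemma spectral_gap:
  assumes "(\<Sum>x\<in>R. h x) = 0"
  shows "swap_rate / poincare_constant * (\<Sum>x\<in>R. (h x)\<^sup>2) \<le> chain.dirichlet h"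
proof -
  have N: "real (card R) > 0" using chain.fin chain.ne by (simp add: card_gt_0_iff)
  have B: "poincare_constant > 0" by (simp add: poincare_constant_def)
  have "(\<Sum>G\<in>R. \<Sum>G'\<in>R. (h G - h G')\<^sup>2) = 
     (\<Sum>G\<in>R. \<Sum>G'\<in>R. (h G)\<^sup>2) + (\<Sum>G\<in>R. \<Sum>G'\<in>R. (h G')\<^sup>2) - (\<Sum>G\<in>R. \<Sum>G'\<in>R. 2 * h G * h G')"
    by (simp only: power2_diff sum.distrib[symmetric] sum_subtractf[symmetric])
  also have "(\<Sum>G\<in>R. \<Sum>G'\<in>R. 2 * h G * h G') = 0"
    using assms by (simp flip: sum_distrib_left)
  finally have "2 * real (card R) * (\<Sum>x\<in>R. (h x)\<^sup>2) = (\<Sum>G\<in>R. \<Sum>G'\<in>R. (h G - h G')\<^sup>2)"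
    by (simp flip: sum_distrib_left)
  also have "\<dots> \<le> poincare_constant * real (card R) * swap_energy R R h" by (rule swap_poincare)
  finally have "2 * (\<Sum>x\<in>R. (h x)\<^sup>2) \<le> poincare_constant * swap_energy R R h"
    using N by (simp add: mult.assoc mult.left_commute)
  then have "swap_rate * (2 * (\<Sum>x\<in>R. (h x)\<^sup>2)) \<le> swap_rate * (poincare_constant * swap_energy R R h)"
    using swap_rate_bounds by (intro mult_left_mono) auto
  then show ?thesis using B by (simp add: dirichlet_swap field_simps)
qed

lemma mixing_time_le:
  assumes eps: "0 < eps" "eps < 1"
  shows "real (mixing_time n m du dv eps)
     \<le> (ln (real (card R)) + 2 * ln (1 / eps)) * poincare_constant / swap_rate + 1"
proof -
  have N: "real (card R) \<ge> 1" using chain.fin chain.ne by (simp add: card_gt_0_iff Suc_leI)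
  have B: "poincare_constant \<ge> 1"
  proof -
    have "1 \<le> real (card cells + 1) ^ 129" by (rule one_le_power) simp
    then show ?thesis unfolding poincare_constant_def by linarith
  qed
  define lam where "lam = swap_rate / poincare_constant"
  have lam: "0 < lam" "lam \<le> 1" using swap_rate_bounds B by (auto simp: lam_def divide_le_eq_1)
  define T where "T = (ln (real (card R)) + 2 * ln (1 / eps)) / lam"
  have T0: "0 \<le> T" using N eps lam by (auto simp: T_def)
  have "(LEAST t. swap_tv n m du dv t G \<le> eps) \<le> nat \<lceil>T\<rceil>" if G: "G \<in> R" for G
  proof (rule Least_le)
    have "(\<Sum>x\<in>R. \<bar>swap_Pt n m du dv (nat \<lceil>T\<rceil>) G x - 1 / real (card R)\<bar>) \<le> eps"
    proof (rule chain.total_variation_le[OF lam eps(1) _ _ G])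
      show "(ln (real (card R)) + 2 * ln (1 / eps)) / lam \<le> real (nat \<lceil>T\<rceil>)"
        unfolding T_def[symmetric] by linarith
    qed (use spectral_gap in \<open>auto simp: lam_def\<close>)
    then show "swap_tv n m du dv (nat \<lceil>T\<rceil>) G \<le> eps"
      using eps by (simp add: swap_tv_def)
  qed
  then have "mixing_time n m du dv eps \<le> nat \<lceil>T\<rceil>"
    unfolding mixing_time_def using chain.fin chain.ne by (subst Max_le_iff) auto
  then have "real (mixing_time n m du dv eps) \<le> T + 1" using T0 by linarith
  then show ?thesis by (simp add: T_def lam_def)
qed

text \<open>Let \<open>S\<close> be the base of the power; it is at least 1. There are at most
  \<open>S\<^sup>2\<close> cells, hence \<open>ln (real (card R))\<close> is at most
  \<open>S\<^sup>2\<close> too. The time bound multiplies \<open>3 * S\<^sup>2\<close>, the Poincare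
  constant of degree 258 and the inverse rate \<open>2 * S ^ 4\<close>, which gives 2 + 258 + 4 =
  264.\<close>

lemma mixing_time_polynomial:
  assumes eps: "0 < eps" "eps < 1"
  shows "real (mixing_time n m du dv eps)
     \<le> (3 * 819200 * 2 ^ 130 + 1) * (real (n + m) + ln (1 / eps)) ^ 264"
proof -
  define S where "S = real (n + m) + ln (1 / eps)"
  have ln0: "0 \<le> ln (1 / eps)" using eps by simp
  have S: "real n \<le> S" "real m \<le> S" "ln (1 / eps) \<le> S" "1 \<le> S"
    using ln0 c by (auto simp: S_def)
  have S2: "S \<le> S\<^sup>2" "1 \<le> S\<^sup>2"
    using S(4) mult_left_mono[of 1 S S] one_le_power[of S 2] by (simp_all add: power2_eq_square)
  have cells: "real (card cells) \<le> S\<^sup>2"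
    using S by (auto simp: cells_def power2_eq_square intro!: mult_mono)
  have "card R \<le> card (Pow cells)" using finite_cells realization_cells by (intro card_mono) auto
  also have "\<dots> = 2 ^ card cells" by (rule card_Pow[OF finite_cells(1)])
  finally have "real (card R) \<le> 2 ^ card cells" by (metis of_nat_mono of_nat_numeral of_nat_power)
  then have "ln (real (card R)) \<le> ln (2 ^ card cells)"
    using chain.fin chain.ne by (simp add: card_gt_0_iff)
  also have "\<dots> = real (card cells) * ln 2" by (simp add: ln_realpow)
  also have "\<dots> \<le> real (card cells) * 1" using ln_2_less_1 by (intro mult_left_mono) auto
  finally have lnR: "ln (real (card R)) \<le> S\<^sup>2" using cells by simp
  have num: "ln (real (card R)) + 2 * ln (1 / eps) \<le> 3 * S\<^sup>2" using lnR S S2 by linarith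
  have "poincare_constant \<le> 819200 * (2 * S\<^sup>2) ^ 129"
    unfolding poincare_constant_def using cells S2 by (intro mult_left_mono power_mono) auto
  also have "\<dots> = 819200 * 2 ^ 129 * S ^ 258" by (simp add: power_mult_distrib flip: power_mult)
  finally have pc: "poincare_constant \<le> 819200 * 2 ^ 129 * S ^ 258" .
  have choose: "real (k choose 2) \<le> S\<^sup>2" if "real k \<le> S" for k
  proof -
    have "k choose 2 \<le> k ^ 2" by (cases "2 \<le> k") (simp_all add: binomial_le_pow binomial_eq_0)
    then have "real (k choose 2) \<le> real k ^ 2" by (metis of_nat_mono of_nat_power)
    also have "\<dots> \<le> S\<^sup>2" using that by (intro power_mono) auto
    finally show ?thesis .
  qed
  have "1 / swap_rate = 2 * real (n choose 2) * real (m choose 2)" by (simp add: swap_rate_def)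
  also have "\<dots> \<le> 2 * S\<^sup>2 * S\<^sup>2" using choose S by (intro mult_mono) auto
  finally have rate: "1 / swap_rate \<le> 2 * S ^ 4" by (simp add: mult.assoc flip: power_add)
  have "real (mixing_time n m du dv eps)
      \<le> (ln (real (card R)) + 2 * ln (1 / eps)) * poincare_constant * (1 / swap_rate) + 1"
    using mixing_time_le[OF eps] by simp
  also have "\<dots> \<le> (3 * S\<^sup>2) * (819200 * 2 ^ 129 * S ^ 258) * (2 * S ^ 4) + 1"
    using num pc rate S swap_rate_bounds
    by (intro add_mono mult_mono) (auto simp: poincare_constant_def)
  also have "\<dots> = 3 * 819200 * 2 ^ 130 * S ^ 264 + 1"
    by (simp flip: power_add)
  also have "\<dots> \<le> (3 * 819200 * 2 ^ 130 + 1) * S ^ 264"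
    using one_le_power[OF S(4), of 264] by (simp add: distrib_right)
  finally show ?thesis unfolding S_def .
qed

end

theorem theorem2:
  "\<exists>(C::real) (k::nat). \<forall>n m (c1::nat) c2 d1 d2 du dv (\<epsilon>::real).
     0 < c1 \<and> c1 \<le> c2 \<and> c2 < n \<and> 0 < d1 \<and> d1 \<le> d2 \<and> d2 < m \<and>
     realizations n m du dv \<noteq> {} \<and>
     (\<forall>j<m. c1 \<le> dv j \<and> dv j \<le> c2) \<and>
     (\<forall>i<n. d1 \<le> du i \<and> du i \<le> d2) \<and>
     (int c2 - int c1 - 1) * (int d2 - int d1 - 1)
        \<le> max (int c1 * (int m - int d2)) (int d1 * (int n - int c2)) \<and>
     0 < \<epsilon> \<and> \<epsilon> < 1
     \<longrightarrow> real (mixing_time n m du dv \<epsilon>) \<le> C * (real (n + m) + ln (1 / \<epsilon>)) ^ k"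
proof (intro exI allI impI, elim conjE)
  fix n m c1 c2 d1 d2 :: nat and du dv :: "nat \<Rightarrow> nat" and \<epsilon> :: real
  assume hyps: "0 < c1" "c1 \<le> c2" "c2 < n" "0 < d1" "d1 \<le> d2" "d2 < m" "\<forall>j<m. c1 \<le> dv j \<and> dv j \<le> c2"
    "\<forall>i<n. d1 \<le> du i \<and> du i \<le> d2"
    "(int c2 - int c1 - 1) * (int d2 - int d1 - 1) \<le> max (int c1 * (int m - int d2)) (int d1 * (int n - int c2))"
    and ne: "realizations n m du dv \<noteq> {}" and eps: "0 < \<epsilon>" "\<epsilon> < 1"
  obtain G0 where "G0 \<in> realizations n m du dv" using ne by blast
  then interpret lifted_realizations n m c1 c2 d1 d2 du dv G0
    using hyps by unfold_locales auto
  show "real (mixing_time n m du dv \<epsilon>) \<le> (3 * 819200 * 2 ^ 130 + 1) * (real (n + m) + ln (1 / \<epsilon>)) ^ 264"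
    by (rule mixing_time_polynomial[OF eps])
qed

end
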